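(* Let $s\in(0,1]$ and $p\in[1,+\infty)$ be such that $sp=N$ and $s\neq p$. Let $\widetilde s\in[0,1]$ and $\widetilde p\in[1,+\infty]$. If $\widetilde s$ and $\widetilde p$ do not satisfy $$\text{either}\quad\begin{cases}0<\widetilde s\le s,\\ p\le\widetilde p\le\dfrac{N}{\widetilde s},\end{cases}\qquad\text{or}\qquad\begin{cases}\widetilde s=0,\\ p\le\widetilde p<+\infty,\end{cases}$$ then the space $W^{s,p}(\mathbb{R}^N)$ is not continuously embedded in $W^{\widetilde s,\widetilde p}(\mathbb{R}^N)$.
   Context: $N\ge1$ is an integer and functions are real-valued and measurable. Let $\Omega$ be either $\mathbb{R}^N$ or an open bounded subset of $\mathbb{R}^N$ with Lipschitz boundary. For $s\in[0,1]$ and $p\in[1,+\infty)$ define $[u]_{W^{0,p}(\Omega)}:=\|u\|_{L^p(\Omega)}$, $[u]_{W^{1,p}(\Omega)}:=\|\nabla u\|_{L^p(\Omega)}$ (weak gradient) and, for $s\in(0,1)$, $$[u]_{W^{s,p}(\Omega)}:=\left(c_{N,s,p}\iint_{\Omega\times\Omega}\frac{|u(x)-u(y)|^p}{|x-y|^{N+sp}}\,dx\,dy\right)^{1/p},\qquad c_{N,s,p}:=\frac{s\,2^{2s-1}\,\Gamma\left(\frac{ps+p+N-2}{2}\right)}{\pi^{N/2}\,\Gamma(1-s)}.$$ Set $W^{s,p}(\Omega):=\{u\in L^p(\Omega):[u]_{W^{s,p}(\Omega)}<+\infty\}$, with norm $\|u\|_{W^{0,p}(\Omega)}:=\|u\|_{L^p(\Omega)}$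 if $s=0$ and $\|u\|_{W^{s,p}(\Omega)}:=\big([u]^p_{W^{s,p}(\Omega)}+\|u\|^p_{L^p(\Omega)}\big)^{1/p}$ if $s\in(0,1]$. For $p=+\infty$: $W^{0,\infty}(\Omega):=L^\infty(\Omega)$ and, for $s\in(0,1]$, $W^{s,\infty}(\Omega):=C^{0,s}(\Omega)$ with norm $\|u\|_{L^\infty(\Omega)}+\sup_{x\neq y\in\Omega}\frac{|u(x)-u(y)|}{|x-y|^s}$ (functions being identified up to a.e. equality). *)

theory Defs
  imports "HOL-Probability.Essential_Supremum"
begin

text \<open>
  Functions are total maps \<open>'a \<Rightarrow> real\<close> on a Euclidean space \<open>'a\<close> of dimension \<open>N = DIM('a)\<close>; only
  their values on \<open>\<Omega>\<close> matter. Almost-everywhere classes are represented by their members: all spaces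
  below are closed under a.e. equality on \<open>\<Omega>\<close>, and all (semi)norms of spaces of a.e. classes are
  invariant under it. Norms take values in \<open>ennreal\<close>, with value \<open>\<infinity>\<close> outside the space.
\<close>

text \<open>Only used with exponent \<open>a > 0\<close>.\<close>

definition ennreal_powr :: "ennreal \<Rightarrow> real \<Rightarrow> ennreal" where
  "ennreal_powr X a = (if X = \<infinity> then \<infinity> else ennreal (enn2real X powr a))"

definition Lp_norm :: "'a::euclidean_space set \<Rightarrow> ereal \<Rightarrow> ('a \<Rightarrow> real) \<Rightarrow> ennreal" where
  "Lp_norm \<Omega> p u =
     (if p = \<infinity> then esssup (lebesgue_on \<Omega>) (\<lambda>x. ennreal \<bar>u x\<bar>)
      else ennreal_powr
             (\<integral>\<^sup>+x. ennreal (\<bar>u x\<bar> powr real_of_ereal p) \<partial>lebesgue_on \<Omega>) (1 / real_of_ereal p))"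

definition Lp_space :: "'a::euclidean_space set \<Rightarrow> ereal \<Rightarrow> ('a \<Rightarrow> real) set" where
  "Lp_space \<Omega> p = {u \<in> borel_measurable (lebesgue_on \<Omega>). Lp_norm \<Omega> p u < \<infinity>}"

primrec Ck :: "nat \<Rightarrow> ('a::euclidean_space \<Rightarrow> real) \<Rightarrow> bool" where
  "Ck 0 \<phi> \<longleftrightarrow> continuous_on UNIV \<phi>"
| "Ck (Suc k) \<phi> \<longleftrightarrow> (\<forall>x. \<phi> differentiable (at x)) \<and>
     (\<forall>i\<in>Basis. Ck k (\<lambda>x. frechet_derivative \<phi> (at x) i))"

definition test_functions :: "'a::euclidean_space set \<Rightarrow> ('a \<Rightarrow> real) set" where
  "test_functions \<Omega> =
     {\<phi>. (\<forall>k. Ck k \<phi>) \<and> compact (closure {x. \<phi> x \<noteq> 0}) \<and> closure {x. \<phi> x \<noteq> 0} \<subseteq> \<Omega>}"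

definition locally_integrable ::
    "'a::euclidean_space set \<Rightarrow> ('a \<Rightarrow> 'b::euclidean_space) \<Rightarrow> bool" where
  "locally_integrable \<Omega> f \<longleftrightarrow> (\<forall>K. compact K \<and> K \<subseteq> \<Omega> \<longrightarrow> integrable (lebesgue_on K) f)"

definition weak_gradient ::
    "'a::euclidean_space set \<Rightarrow> ('a \<Rightarrow> real) \<Rightarrow> ('a \<Rightarrow> 'a) \<Rightarrow> bool" where
  "weak_gradient \<Omega> u g \<longleftrightarrow> locally_integrable \<Omega> u \<and> locally_integrable \<Omega> g \<and>
     (\<forall>\<phi>\<in>test_functions \<Omega>. \<forall>i\<in>Basis.
        (\<integral>x. u x * frechet_derivative \<phi> (at x) i \<partial>lebesgue_on \<Omega>) =
        - (\<integral>x. (g x \<bullet> i) * \<phi> x \<partial>lebesgue_on \<Omega>))"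

definition c_const :: "nat \<Rightarrow> real \<Rightarrow> real \<Rightarrow> real" where
  "c_const N s p =
     s * 2 powr (2 * s - 1) * Gamma ((p * s + p + real N - 2) / 2) /
     (pi powr (real N / 2) * Gamma (1 - s))"

definition gagliardo :: "'a::euclidean_space set \<Rightarrow> real \<Rightarrow> real \<Rightarrow> ('a \<Rightarrow> real) \<Rightarrow> ennreal" where
  "gagliardo \<Omega> s p u =
     ennreal_powr
       (ennreal (c_const DIM('a) s p) *
        (\<integral>\<^sup>+(x, y). ennreal (\<bar>u x - u y\<bar> powr p / norm (x - y) powr (real DIM('a) + s * p))
           \<partial>(lebesgue_on \<Omega> \<Otimes>\<^sub>M lebesgue_on \<Omega>)))
       (1 / p)"

text \<open>
  In the case \<open>s = 1\<close>, the weak gradient on an open set is unique up to null sets, so the infimum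
  ranges over a single value, the \<open>L\<^sup>p\<close> norm of the weak gradient; if there is no weak gradient
  then it is \<open>Inf {} = \<infinity>\<close>.
\<close>

definition sobolev_seminorm ::
    "'a::euclidean_space set \<Rightarrow> real \<Rightarrow> real \<Rightarrow> ('a \<Rightarrow> real) \<Rightarrow> ennreal" where
  "sobolev_seminorm \<Omega> s p u =
     (if s = 0 then Lp_norm \<Omega> (ereal p) u
      else if s = 1 then (INF g\<in>{g. weak_gradient \<Omega> u g}. Lp_norm \<Omega> (ereal p) (\<lambda>x. norm (g x)))
      else gagliardo \<Omega> s p u)"

definition holder_norm :: "'a::euclidean_space set \<Rightarrow> real \<Rightarrow> ('a \<Rightarrow> real) \<Rightarrow> ennreal" where
  "holder_norm \<Omega> s v =
     Lp_norm \<Omega> \<infinity> v +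
     (SUP (x, y)\<in>{(x, y). x \<in> \<Omega> \<and> y \<in> \<Omega> \<and> x \<noteq> y}. ennreal (\<bar>v x - v y\<bar> / norm (x - y) powr s))"

definition holder_space :: "'a::euclidean_space set \<Rightarrow> real \<Rightarrow> ('a \<Rightarrow> real) set" where
  "holder_space \<Omega> s = {v. holder_norm \<Omega> s v < \<infinity>}"

definition holder_representatives ::
    "'a::euclidean_space set \<Rightarrow> real \<Rightarrow> ('a \<Rightarrow> real) \<Rightarrow> ('a \<Rightarrow> real) set" where
  "holder_representatives \<Omega> s u = {v \<in> holder_space \<Omega> s. AE x in lebesgue_on \<Omega>. u x = v x}"

definition sobolev_space :: "'a::euclidean_space set \<Rightarrow> real \<Rightarrow> ereal \<Rightarrow> ('a \<Rightarrow> real) set" where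
  "sobolev_space \<Omega> s p =
     (if p = \<infinity> then
        (if s = 0 then Lp_space \<Omega> \<infinity> else {u. holder_representatives \<Omega> s u \<noteq> {}})
      else {u \<in> Lp_space \<Omega> p. sobolev_seminorm \<Omega> s (real_of_ereal p) u < \<infinity>})"

text \<open>
  For \<open>p = \<infinity>\<close>, \<open>s > 0\<close> and open \<open>\<Omega>\<close>, two Hoelder representatives of the same function are
  continuous and a.e. equal, hence agree on \<open>\<Omega>\<close>, so that the infimum is the norm of the
  representative.
\<close>

definition sobolev_norm :: "'a::euclidean_space set \<Rightarrow> real \<Rightarrow> ereal \<Rightarrow> ('a \<Rightarrow> real) \<Rightarrow> ennreal" where
  "sobolev_norm \<Omega> s p u =
     (if p = \<infinity> then
        (if s = 0 then Lp_norm \<Omega> \<infinity> u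
         else (INF v\<in>holder_representatives \<Omega> s u. holder_norm \<Omega> s v))
      else if s = 0 then Lp_norm \<Omega> p u
      else ennreal_powr
             (ennreal_powr (sobolev_seminorm \<Omega> s (real_of_ereal p) u) (real_of_ereal p) +
              ennreal_powr (Lp_norm \<Omega> p u) (real_of_ereal p))
             (1 / real_of_ereal p))"

definition continuously_embedded ::
    "'a::euclidean_space set \<Rightarrow> real \<Rightarrow> ereal \<Rightarrow> real \<Rightarrow> ereal \<Rightarrow> bool" where
  "continuously_embedded \<Omega> s p s' p' \<longleftrightarrow>
     sobolev_space \<Omega> s p \<subseteq> sobolev_space \<Omega> s' p' \<and>
     (\<exists>C::real. \<forall>u\<in>sobolev_space \<Omega> s p.
        sobolev_norm \<Omega> s' p' u \<le> ennreal C * sobolev_norm \<Omega> s p u)"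

end

theory Submission
  imports Defs
begin

text \<open>
  Everything is tested on the dilations \<open>bump m x = \<phi> (m x)\<close> of one smooth bump function. As \<open>s p = N\<close>,
  the seminorm of the source does not depend on \<open>m\<close>, while \<open>\<parallel>bump m\<parallel>\<^sub>p\<close> is \<open>m\<close> to the power \<open>-N/p\<close>, up to
  a constant. Letting \<open>m \<rightarrow> 0\<close> forces \<open>p \<le> p'\<close>; letting \<open>m \<rightarrow> \<infinity>\<close> forces \<open>s' p' \<le> N\<close> if \<open>s' > 0\<close>. The only
  scaling invariant case is \<open>s' = 0\<close>, \<open>p' = \<infinity>\<close>: since \<open>p > 1\<close> and the (fractional) gradients of
  \<open>bump (2 ^ k)\<close> are bounded in \<open>L\<^sup>p\<close> and tend to zero almost everywhere, a Brezis-Lieb type estimate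
  yields averages of them that are small in norm (as in the Banach-Saks theorem), whereas the averages
  of the functions themselves stay bounded below near the origin.
\<close>

text \<open>\<open>p > 1\<close> comes from \<open>s \<noteq> p\<close>: for \<open>p = 1\<close>
  the relation \<open>s p = N\<close> would force \<open>s = N = 1 = p\<close>. It is what makes
  averages small: a sum of \<open>n\<close> well chosen terms has p-th power integral of order
  \<open>n\<close>, and averaging divides this by \<open>n powr p\<close>. For a finite target
  exponent \<open>q \<ge> p\<close>, every excluded pair has \<open>s' q > N\<close>, whether or not
  \<open>s' \<le> s\<close>. The obstacle is that lower bounds in the target concern unknown
  objects: the norm is an infimum over all weak gradients if \<open>s' = 1\<close>, an infimum over
  all representatives in the Hoelder case, an essential supremum for L-infinity. An unknown gradient
  is paired with a derivative of the bump itself; in the other two cases points are picked from open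
  sets, which are not null. The sources with \<open>s = 1\<close> and \<open>s < 1\<close> share one
  argument, since both seminorms are L^p norms of a nonnegative expression sublinear in u: the
  length of the gradient on R^N, or \<open>\<bar>u x - u y\<bar>\<close> on R^N x R^N with the
  kernel as density.\<close>

lemma ennreal_powr_ennreal: "0 \<le> r \<Longrightarrow> ennreal_powr (ennreal r) a = ennreal (r powr a)"
  by (simp add: ennreal_powr_def)

lemma ennreal_powr_mono:
  assumes "X \<le> Y" "0 < a"
  shows "ennreal_powr X a \<le> ennreal_powr Y a"
proof (cases Y)
  case (real r)
  then have "X < \<infinity>" using assms(1) by (metis ennreal_less_top infinity_ennreal_def order_le_less_trans)
  with real assms show ?thesis
    by (cases X) (auto simp: ennreal_powr_ennreal powr_mono2 intro!: ennreal_leI)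
qed (simp add: ennreal_powr_def)

lemma ennreal_powr_inverse:
  assumes "0 < a" "a * b = 1"
  shows "ennreal_powr (ennreal_powr X a) b = X"
  using assms by (cases X) (auto simp: ennreal_powr_ennreal powr_powr, auto simp: ennreal_powr_def)

lemma ennreal_powr_le_imp_le:
  assumes "0 < a" "0 \<le> r" "ennreal_powr X (1 / a) \<le> ennreal r"
  shows "X \<le> ennreal (r powr a)"
  using ennreal_powr_mono[OF assms(3,1)] assms
  by (simp add: ennreal_powr_inverse ennreal_powr_ennreal)

text \<open>The common end of all scaling arguments: each derives a bound on a positive power of the
  dilation parameter that is uniform over parameters at least 1.\<close>

lemma powr_not_bounded:
  fixes e K :: real
  assumes "0 < e" and bd: "\<And>x. 1 \<le> x \<Longrightarrow> x powr e \<le> K"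
  shows False
proof -
  have "1 \<le> max 1 (K + 1) powr (1 / e)" using assms(1) by (simp add: ge_one_powr_ge_zero)
  from bd[OF this] assms(1) show False by (auto simp: powr_powr)
qed

section \<open>Change of variables, and reduction of Lebesgue integrals to Borel ones\<close>

lemma nn_integral_lborel_affine:
  fixes f :: "'a::euclidean_space \<Rightarrow> ennreal"
  assumes [measurable]: "f \<in> borel_measurable borel" and c: "c \<noteq> 0"
  shows "(\<integral>\<^sup>+x. f (t + c *\<^sub>R x) \<partial>lborel) = ennreal (\<bar>c\<bar> powr - real DIM('a)) * (\<integral>\<^sup>+x. f x \<partial>lborel)"
proof -
  have "(\<integral>\<^sup>+x. f x \<partial>lborel) = ennreal (\<bar>c\<bar> ^ DIM('a)) * (\<integral>\<^sup>+x. f (t + c *\<^sub>R x) \<partial>lborel)"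
    using c by (subst lborel_affine[OF c, of t])
      (simp add: nn_integral_density nn_integral_distr nn_integral_cmult)
  moreover have "ennreal (\<bar>c\<bar> powr - real DIM('a)) * ennreal (\<bar>c\<bar> ^ DIM('a)) = 1"
    using c by (simp add: powr_minus powr_realpow flip: ennreal_mult)
  ultimately show ?thesis by (simp add: mult.assoc[symmetric])
qed

lemma nn_integral_lborel_scale:
  fixes f :: "'a::euclidean_space \<Rightarrow> ennreal"
  assumes "f \<in> borel_measurable borel" and c: "0 < c"
  shows "(\<integral>\<^sup>+x. f (c *\<^sub>R x) \<partial>lborel) = ennreal (c powr - real DIM('a)) * (\<integral>\<^sup>+x. f x \<partial>lborel)"
  using nn_integral_lborel_affine[OF assms(1), of c 0] c by simp

lemma emeasure_lborel_ball_scale: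
  assumes "0 < c"
  shows "emeasure lborel (ball (0::'a::euclidean_space) (1 / c)) =
     ennreal (c powr - real DIM('a) * measure lborel (ball (0::'a) 1))"
proof -
  have "emeasure lborel (ball (0::'a) (1 / c)) = (\<integral>\<^sup>+x. indicator (ball (0::'a) 1) (c *\<^sub>R x) \<partial>lborel)"
    using assms by (subst nn_integral_indicator[symmetric], simp, intro nn_integral_cong)
      (simp add: indicator_def field_simps abs_of_pos)
  also have "\<dots> = ennreal (c powr - real DIM('a)) * emeasure lborel (ball (0::'a) 1)"
    by (subst nn_integral_lborel_scale[OF _ assms]) (auto intro!: borel_measurable_indicator)
  also have "emeasure lborel (ball (0::'a) 1) = ennreal (measure lborel (ball (0::'a) 1))"
    using emeasure_lborel_ball_finite[of "0::'a" 1] by (intro emeasure_eq_ennreal_measure) auto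
  finally show ?thesis by (simp add: ennreal_mult')
qed

lemma sigma_finite_lebesgue: "sigma_finite_measure (lebesgue :: 'a::euclidean_space measure)"
proof
  obtain A :: "'a set set" where "countable A" "A \<subseteq> sets lborel" "\<Union> A = space lborel"
    "\<forall>a\<in>A. emeasure lborel a \<noteq> \<infinity>"
    using lborel.sigma_finite_countable by blast
  then show "\<exists>A::'a set set. countable A \<and> A \<subseteq> sets lebesgue \<and> \<Union> A = space lebesgue \<and>
      (\<forall>a\<in>A. emeasure lebesgue a \<noteq> \<infinity>)"
    by (intro exI[of _ A]) auto
qed

text \<open>The Gagliardo integral lives on a product of two completed measures. The identity from
  the completed to the Borel algebra is measurable in each factor, so Borel integrands remain
  measurable there; afterwards each of the two iterated integrals loses its completion
  separately.\<close>

lemma borel_measurable_lebesgue_pair: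
  fixes g :: "'a::euclidean_space \<times> 'a \<Rightarrow> ennreal"
  assumes g: "g \<in> borel_measurable borel"
  shows "g \<in> borel_measurable (lebesgue \<Otimes>\<^sub>M lebesgue)"
proof -
  have "(\<lambda>x. x) \<in> (lebesgue::'a measure) \<rightarrow>\<^sub>M borel"
    by (rule measurable_completion) simp
  then have "(\<lambda>z. (fst z, snd z)) \<in> (lebesgue::'a measure) \<Otimes>\<^sub>M (lebesgue::'a measure) \<rightarrow>\<^sub>M borel \<Otimes>\<^sub>M borel"
    by (intro measurable_Pair measurable_compose[OF measurable_fst] measurable_compose[OF measurable_snd])
  then show ?thesis using measurable_compose g by (fastforce simp: borel_prod)
qed

lemma nn_integral_lebesgue_pair:
  fixes g :: "'a::euclidean_space \<times> 'a \<Rightarrow> ennreal"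
  assumes g: "g \<in> borel_measurable borel"
  shows "(\<integral>\<^sup>+z. g z \<partial>(lebesgue \<Otimes>\<^sub>M lebesgue)) = (\<integral>\<^sup>+x. \<integral>\<^sup>+y. g (x, y) \<partial>lborel \<partial>lborel)"
proof -
  interpret sigma_finite_measure "lebesgue :: 'a measure" by (rule sigma_finite_lebesgue)
  show ?thesis
    by (subst nn_integral_fst[symmetric, OF borel_measurable_lebesgue_pair[OF g]])
      (simp add: nn_integral_completion)
qed

lemma nn_integral_lborel_pair:
  fixes g :: "'a::euclidean_space \<times> 'a \<Rightarrow> ennreal"
  assumes g: "g \<in> borel_measurable borel"
  shows "(\<integral>\<^sup>+z. g z \<partial>lborel) = (\<integral>\<^sup>+x. \<integral>\<^sup>+y. g (x, y) \<partial>lborel \<partial>lborel)"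
  using g by (subst lborel.nn_integral_fst) (auto simp: lborel_prod)

section \<open>A smooth bump function and its dilations\<close>

text \<open>The classical flat function \<open>exp (- 1 / t)\<close> divided by powers of
  \<open>t\<close>. The powers are carried along because derivatives stay in the span of the family:
  differentiating produces indices \<open>j + 1\<close> and \<open>j + 2\<close>.\<close>

definition flat :: "nat \<Rightarrow> real \<Rightarrow> real" where
  "flat j t = (if t \<le> 0 then 0 else exp (- 1 / t) / t ^ j)"

text \<open>Written through \<open>x \<bullet> x\<close> rather than the norm, so that no separate
  argument is needed for differentiability at the origin.\<close>

definition bump :: "real \<Rightarrow> 'a::euclidean_space \<Rightarrow> real" where
  "bump m x = flat 0 (1 - m\<^sup>2 * (x \<bullet> x))"

definition bump_grad :: "real \<Rightarrow> 'a::euclidean_space \<Rightarrow> 'a" where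
  "bump_grad m x = (- 2 * m\<^sup>2 * flat 2 (1 - m\<^sup>2 * (x \<bullet> x))) *\<^sub>R x"

lemma flat_nonneg: "0 \<le> flat j t" by (simp add: flat_def)

text \<open>From the right, substituting \<open>1 / t\<close> turns the claim into the decay of a
  power times \<open>exp (- t)\<close> at infinity.\<close>

lemma flat_tendsto_0: "(flat j \<longlongrightarrow> 0) (at 0)"
proof -
  have "((\<lambda>t::real. t ^ j * exp (- t)) \<longlongrightarrow> 0) at_top"
    using tendsto_power_div_exp_0[of j] by (simp add: exp_minus divide_inverse)
  then have "((\<lambda>t::real. exp (- 1 / t) / t ^ j) \<longlongrightarrow> 0) (at_right 0)"
    using filterlim_compose[of "\<lambda>t::real. t ^ j * exp (- t)" _ at_top inverse, OF _ filterlim_inverse_at_top_right]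
    by (simp add: field_simps)
  then have "(flat j \<longlongrightarrow> 0) (at_right 0)"
    by (rule tendsto_cong[THEN iffD1, rotated])
       (auto simp: flat_def eventually_at_filter)
  moreover have "(flat j \<longlongrightarrow> 0) (at_left 0)"
    by (rule tendsto_eventually) (auto simp: flat_def eventually_at_filter)
  ultimately show ?thesis by (simp add: filterlim_split_at)
qed

lemma flat_has_derivative:
  "(flat j has_real_derivative (flat (j + 2) t - j * flat (j + 1) t)) (at t)"
proof (cases t "0::real" rule: linorder_cases)
  case less
  have "((\<lambda>_. 0) has_real_derivative 0) (at t)" by simp
  then have "(flat j has_real_derivative 0) (at t)"
    by (rule has_field_derivative_transform_within_open[of _ _ _ "{..<0}"]) (use less in \<open>auto simp: flat_def\<close>)
  then show ?thesis using less by (simp add: flat_def)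
next
  case equal
  \<comment> \<open>The difference quotient of \<open>flat j\<close> at 0 is
    \<open>flat (Suc j)\<close> itself.\<close>
  have "((\<lambda>h. (flat j (0 + h) - flat j 0) / h) \<longlongrightarrow> 0) (at 0)"
    using flat_tendsto_0[of "Suc j"]
    by (rule tendsto_cong[THEN iffD1, rotated]) (auto simp: flat_def eventually_at_filter)
  then show ?thesis using equal by (simp add: flat_def DERIV_def)
next
  case greater
  have "((\<lambda>t. exp (- 1 / t) / t ^ j) has_real_derivative (flat (j + 2) t - j * flat (j + 1) t)) (at t)"
    using greater
    apply (auto intro!: derivative_eq_intros simp: flat_def)
    apply (cases j; simp add: field_simps power2_eq_square)
    done
  then show ?thesis
    by (rule has_field_derivative_transform_within_open[of _ _ _ "{0<..}"]) (use greater in \<open>auto simp: flat_def\<close>)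
qed

lemma flat_radial_has_derivative:
  "((\<lambda>x. flat j (1 - m\<^sup>2 * (x \<bullet> x))) has_derivative
     (\<lambda>h. (flat (j + 2) (1 - m\<^sup>2 * (x \<bullet> x)) - j * flat (j + 1) (1 - m\<^sup>2 * (x \<bullet> x))) * (- 2 * m\<^sup>2 * (x \<bullet> h))))
   (at (x::'a::euclidean_space))"
proof -
  have "((\<lambda>x. 1 - m\<^sup>2 * (x \<bullet> x)) has_derivative (\<lambda>h. - 2 * m\<^sup>2 * (x \<bullet> h))) (at x)"
    by (auto intro!: derivative_eq_intros simp: inner_commute algebra_simps)
  from has_derivative_compose[OF this flat_has_derivative[unfolded has_field_derivative_def]]
  show ?thesis by simp
qed

lemma bump_has_derivative: "(bump m has_derivative (\<lambda>h. bump_grad m x \<bullet> h)) (at x)"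
  using flat_radial_has_derivative[of 0 m x]
  by (simp add: bump_def[abs_def] bump_grad_def algebra_simps numeral_2_eq_2)

section \<open>Smoothness of all orders\<close>

lemma Ck_Suc_imp_Ck: "Ck (Suc k) f \<Longrightarrow> Ck k f"
proof (induction k arbitrary: f)
  case 0
  then show ?case by (simp add: continuous_at_imp_continuous_on differentiable_imp_continuous_within)
next
  case (Suc k)
  then show ?case by (metis Ck.simps(2))
qed

lemma Ck_const: "Ck k (\<lambda>_. c)"
  by (induction k arbitrary: c) auto

lemma Ck_inner_left: "Ck k (\<lambda>x. c * (x \<bullet> i))"
proof (cases k)
  case (Suc n)
  have d: "((\<lambda>x. c * (x \<bullet> i)) has_derivative (\<lambda>h. c * (h \<bullet> i))) (at x)" for x :: 'a
    by (auto intro!: derivative_eq_intros)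
  have "(\<lambda>x. c * (x \<bullet> i)) differentiable at x" for x :: 'a
    using d differentiable_def by blast
  moreover have "frechet_derivative (\<lambda>x. c * (x \<bullet> i)) (at x) j = c * (j \<bullet> i)" for x j :: 'a
    using frechet_derivative_at[OF d[of x]] by metis
  ultimately show ?thesis using Suc by (simp add: Ck_const)
qed (simp add: continuous_intros)

lemma Ck_add: "Ck k f \<Longrightarrow> Ck k g \<Longrightarrow> Ck k (\<lambda>x. f x + g x)"
proof (induction k arbitrary: f g)
  case (Suc k)
  then have "(f has_derivative frechet_derivative f (at x)) (at x)"
    "(g has_derivative frechet_derivative g (at x)) (at x)" for x
    by (simp_all flip: frechet_derivative_works)
  from frechet_derivative_at[OF has_derivative_add[OF this]]
  have "frechet_derivative (\<lambda>x. f x + g x) (at x) =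
      (\<lambda>i. frechet_derivative f (at x) i + frechet_derivative g (at x) i)" for x
    by simp
  with Suc show ?case by (auto simp: differentiable_add)
qed (simp add: continuous_on_add)

lemma Ck_mult: "Ck k f \<Longrightarrow> Ck k g \<Longrightarrow> Ck k (\<lambda>x. f x * g x)"
proof (induction k arbitrary: f g)
  case (Suc k)
  from Suc.prems have "(f has_derivative frechet_derivative f (at x)) (at x)"
    "(g has_derivative frechet_derivative g (at x)) (at x)" for x
    by (simp_all flip: frechet_derivative_works)
  from frechet_derivative_at[OF has_derivative_mult[OF this]]
  have d: "frechet_derivative (\<lambda>x. f x * g x) (at x) =
      (\<lambda>i. f x * frechet_derivative g (at x) i + frechet_derivative f (at x) i * g x)" for x
    by simp
  \<comment> \<open>In the product rule \<open>f\<close> and \<open>g\<close> also occur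
    undifferentiated, so their order has to be lowered from \<open>Suc k\<close> to \<open>k\<close>
    before the induction hypothesis applies.\<close>
  have "Ck k (\<lambda>x. f x * frechet_derivative g (at x) i + frechet_derivative f (at x) i * g x)" if "i \<in> Basis" for i
    using Suc.prems that Ck_Suc_imp_Ck[OF Suc.prems(1)] Ck_Suc_imp_Ck[OF Suc.prems(2)]
    by (intro Ck_add Suc.IH) auto
  with Suc.prems show ?case by (auto simp: d differentiable_mult)
qed (simp add: continuous_on_mult)

text \<open>The induction on \<open>k\<close> has to range over all \<open>j\<close>, because the
  derivative involves the indices \<open>j + 1\<close> and \<open>j + 2\<close> times a linear
  function.\<close>

lemma Ck_flat_radial: "Ck k (\<lambda>x::'a::euclidean_space. flat j (1 - m\<^sup>2 * (x \<bullet> x)))"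
proof (induction k arbitrary: j)
  case 0
  show ?case
    unfolding Ck.simps by (intro continuous_at_imp_continuous_on ballI has_derivative_continuous[OF flat_radial_has_derivative])
next
  case (Suc k)
  let ?f = "\<lambda>j x::'a. flat j (1 - m\<^sup>2 * (x \<bullet> x))"
  have "?f j differentiable at x" for x
    using flat_radial_has_derivative differentiable_def by blast
  moreover have "frechet_derivative (?f j) (at x) = (\<lambda>i. (?f (j + 2) x - j * ?f (j + 1) x) * (- 2 * m\<^sup>2 * (x \<bullet> i)))" for x
    by (rule frechet_derivative_at[OF flat_radial_has_derivative, symmetric])
  moreover have "Ck k (\<lambda>x. (?f (j + 2) x + (- real j) * ?f (j + 1) x) * (- 2 * m\<^sup>2 * (x \<bullet> i)))" for i
    by (intro Ck_mult Ck_add Ck_const Ck_inner_left Suc.IH)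
  ultimately show ?case unfolding Ck.simps(2) by simp
qed

lemma frechet_derivative_bump: "frechet_derivative (bump m) (at x) = (\<lambda>h. bump_grad m x \<bullet> h)"
  using frechet_derivative_at[OF bump_has_derivative] by metis

text \<open>These components are the very derivatives that occur in \<open>Ck (Suc k)\<close> of the
  bump, so no new induction is required.\<close>

lemma Ck_bump_grad: "(i::'a::euclidean_space) \<in> Basis \<Longrightarrow> Ck k (\<lambda>x. bump_grad m x \<bullet> i)"
  using Ck_flat_radial[where 'a='a, of "Suc k" 0 m, folded bump_def] by (simp add: frechet_derivative_bump)

section \<open>Support, bounds and scaling of the bump and its gradient\<close>

lemma norm_less_inverse_iff: "0 < m \<Longrightarrow> norm x < 1 / m \<longleftrightarrow> 0 < 1 - m\<^sup>2 * (x \<bullet> x)"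
proof -
  assume m: "0 < m"
  have "norm x < 1 / m \<longleftrightarrow> m * norm x < 1" using m by (simp add: field_simps)
  also have "\<dots> \<longleftrightarrow> (m * norm x)\<^sup>2 < 1" using m by (simp add: power_less_one_iff)
  finally show ?thesis by (simp add: power_mult_distrib dot_square_norm)
qed

lemma bump_eq_0: "0 < m \<Longrightarrow> 1 / m \<le> norm x \<Longrightarrow> bump m x = 0"
  using norm_less_inverse_iff[of m x] by (simp add: bump_def flat_def)

lemma bump_pos: "0 < m \<Longrightarrow> norm x < 1 / m \<Longrightarrow> 0 < bump m x"
  using norm_less_inverse_iff[of m x] by (simp add: bump_def flat_def)

lemma bump_grad_eq_0: "0 < m \<Longrightarrow> 1 / m \<le> norm x \<Longrightarrow> bump_grad m x = 0"
  using norm_less_inverse_iff[of m x] by (simp add: bump_grad_def flat_def)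

lemma bump_nonneg: "0 \<le> bump m x" by (simp add: bump_def flat_nonneg)

lemma bump_le_1: "bump m x \<le> 1" by (simp add: bump_def flat_def)

text \<open>On half the radius of the support \<open>1 - m\<^sup>2 * (x \<bullet> x)\<close> is at
  least 3/4, whence the exponent. The bound does not depend on \<open>m\<close>; this keeps averages
  of several bumps away from 0 near the origin.\<close>

lemma bump_ge:
  assumes "0 < m" "norm x \<le> 1 / (2 * m)"
  shows "exp (- 4 / 3) \<le> bump m x"
proof -
  have "m * norm x \<le> 1 / 2" using assms by (simp add: field_simps)
  then have "(m * norm x)\<^sup>2 \<le> (1 / 2)\<^sup>2" using assms by (intro power_mono) auto
  then have "3 / 4 \<le> 1 - m\<^sup>2 * (x \<bullet> x)" by (simp add: power_mult_distrib dot_square_norm power_divide)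
  moreover from this have "1 / (1 - m\<^sup>2 * (x \<bullet> x)) \<le> 1 / (3 / 4)" by (intro divide_left_mono) auto
  ultimately show ?thesis by (auto simp: bump_def flat_def)
qed

text \<open>This is \<open>exp y \<ge> y\<^sup>2 / 2\<close> at \<open>y = 1 / t\<close>.\<close>

lemma flat_2_le: "flat 2 t \<le> 2"
proof (cases "0 < t")
  case True
  have "1 + 1 / t + (1 / t)\<^sup>2 / 2 \<le> exp (1 / t)"
    using True by (intro exp_lower_Taylor_quadratic) auto
  then have "(1 / t)\<^sup>2 / 2 \<le> exp (1 / t)"
    using True by (smt (verit, best) divide_pos_pos)
  with True show ?thesis by (simp add: flat_def exp_minus field_simps)
qed (simp add: flat_def)

lemma bump_grad_1_le: "norm (bump_grad 1 x) \<le> 4"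
proof (cases "norm x < 1")
  case True
  have "2 * flat 2 (1 - x \<bullet> x) * norm x \<le> 2 * 2 * 1"
    using True flat_2_le flat_nonneg by (intro mult_mono) auto
  then show ?thesis by (simp add: bump_grad_def abs_mult flat_nonneg)
qed (simp add: bump_grad_eq_0)

lemma bump_scale: "bump m x = bump 1 (m *\<^sub>R x)"
  by (simp add: bump_def power2_eq_square mult.assoc)

lemma bump_grad_scale: "bump_grad m x = m *\<^sub>R bump_grad 1 (m *\<^sub>R x)"
  by (simp add: bump_grad_def power2_eq_square mult_ac)

lemma bump_grad_le: "0 < m \<Longrightarrow> norm (bump_grad m x) \<le> 4 * m"
  using bump_grad_1_le[of "m *\<^sub>R x"] by (subst bump_grad_scale) simp

lemma continuous_bump: "continuous_on A (bump m)"
  by (intro continuous_at_imp_continuous_on ballI has_derivative_continuous[OF bump_has_derivative])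

lemma continuous_bump_grad: "continuous_on A (bump_grad m :: 'a::euclidean_space \<Rightarrow> 'a)"
proof -
  have "continuous_on UNIV (\<lambda>x::'a. flat 2 (1 - m\<^sup>2 * (x \<bullet> x)))"
    using Ck_flat_radial[of 0 2 m] by simp
  then have "continuous_on A (\<lambda>x::'a. flat 2 (1 - m\<^sup>2 * (x \<bullet> x)))"
    by (rule continuous_on_subset) simp
  then show ?thesis unfolding bump_grad_def by (intro continuous_intros)
qed

lemma bump_measurable[measurable]: "bump m \<in> borel_measurable borel"
  by (intro borel_measurable_continuous_onI continuous_bump)

lemma bump_grad_measurable[measurable]: "bump_grad m \<in> borel_measurable borel"
  by (intro borel_measurable_continuous_onI continuous_bump_grad)

lemma bump_lipschitz: "\<bar>bump 1 x - bump 1 y\<bar> \<le> 4 * norm (x - y)"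
proof -
  have "norm (bump 1 x - bump 1 y) \<le> 4 * norm (x - y)"
  proof (rule differentiable_bound[of UNIV _ "\<lambda>x h. bump_grad 1 x \<bullet> h"])
    show "onorm (\<lambda>h. bump_grad 1 x \<bullet> h) \<le> 4" for x :: 'a
    proof (rule onorm_le)
      show "norm (bump_grad 1 x \<bullet> h) \<le> 4 * norm h" for h
        using Cauchy_Schwarz_ineq2[of "bump_grad 1 x" h] mult_right_mono[OF bump_grad_1_le[of x], of "norm h"]
        by simp
    qed
  qed (auto intro: bump_has_derivative)
  then show ?thesis by simp
qed

text \<open>Later the partial derivatives of the bump serve as test functions, so that an arbitrary
  weak gradient of the bump can be compared with the classical one.\<close>

lemma bump_grad_test_function:
  assumes "0 < m" "i \<in> Basis"
  shows "(\<lambda>x. bump_grad m x \<bullet> i) \<in> test_functions UNIV"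
proof -
  have "closure {x. bump_grad m x \<bullet> i \<noteq> 0} \<subseteq> cball 0 (1 / m)"
  proof (rule closure_minimal)
    show "{x. bump_grad m x \<bullet> i \<noteq> 0} \<subseteq> cball 0 (1 / m)"
      using bump_grad_eq_0[OF assms(1)] by (force intro: less_imp_le simp flip: not_le)
  qed simp
  then have "bounded (closure {x. bump_grad m x \<bullet> i \<noteq> 0})"
    using bounded_subset by blast
  then have "compact (closure {x. bump_grad m x \<bullet> i \<noteq> 0})"
    by (simp add: compact_eq_bounded_closed)
  then show ?thesis using Ck_bump_grad[OF assms(2)] unfolding test_functions_def by blast
qed

section \<open>Classical gradients are weak gradients\<close>

lemma integrable_compact_support:
  fixes f :: "'a::euclidean_space \<Rightarrow> real"
  assumes "continuous_on UNIV f" and "\<And>x. R \<le> norm x \<Longrightarrow> f x = 0"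
  shows "integrable lborel f"
proof -
  have "integrable lborel (\<lambda>x. indicator (cball 0 R) x *\<^sub>R f x)"
    using assms(1) by (intro borel_integrable_compact continuous_on_subset[OF assms(1)]) auto
  moreover have "(\<lambda>x. indicator (cball 0 R) x *\<^sub>R f x) = f"
    using assms(2) by (auto simp: indicator_def fun_eq_iff)
  ultimately show ?thesis by metis
qed

text \<open>The integral of a directional derivative is the limit of the integrals of difference
  quotients, and each of these vanishes by translation invariance of Lebesgue measure.\<close>

lemma integral_directional_derivative_eq_0:
  fixes F D :: "'a::euclidean_space \<Rightarrow> real"
  assumes der: "\<And>x t. ((\<lambda>t. F (x + t *\<^sub>R i)) has_real_derivative D (x + t *\<^sub>R i)) (at t)"
    and cF: "continuous_on UNIV F" and cD: "continuous_on UNIV D"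
    and F0: "\<And>x. R \<le> norm x \<Longrightarrow> F x = 0" and D0: "\<And>x. R \<le> norm x \<Longrightarrow> D x = 0"
  shows "(\<integral>x. D x \<partial>lborel) = 0"
proof -
  define h where "h n x = real (Suc n) * (F (x + (1 / Suc n) *\<^sub>R i) - F x)" for n x
  have intF: "integrable lborel F" by (rule integrable_compact_support[OF cF F0])
  have [measurable]: "F \<in> borel_measurable borel" "D \<in> borel_measurable borel"
    using cF cD by (auto intro: borel_measurable_continuous_onI)
  have "bounded (D ` cball 0 R)"
    by (intro compact_imp_bounded compact_continuous_image continuous_on_subset[OF cD]) auto
  then obtain L where L: "\<And>x. x \<in> cball 0 R \<Longrightarrow> \<bar>D x\<bar> \<le> L" "0 < L"
    unfolding bounded_pos by force
  have DL: "\<bar>D x\<bar> \<le> L" for x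
    using L(1)[of x] L(2) D0[of x] by (cases "norm x \<le> R") auto
  have mvt: "\<bar>h n x\<bar> \<le> L" for n x
  proof -
    have "\<exists>z. 0 < z \<and> z < 1 / Suc n \<and>
      F (x + (1 / Suc n) *\<^sub>R i) - F (x + 0 *\<^sub>R i) = (1 / Suc n - 0) * D (x + z *\<^sub>R i)"
      by (rule MVT2) (auto intro: der)
    then obtain z where "F (x + (1 / Suc n) *\<^sub>R i) - F x = 1 / Suc n * D (x + z *\<^sub>R i)"
      by auto
    then have "h n x = D (x + z *\<^sub>R i)" by (simp add: h_def)
    then show ?thesis using DL by simp
  qed
  have supp: "h n x = 0" if "R + norm i < norm x" for n x
  proof -
    have "norm ((1 / Suc n) *\<^sub>R i) \<le> norm i" by (simp add: field_simps)
    then have "R \<le> norm (x + (1 / Suc n) *\<^sub>R i)"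
      using that norm_triangle_ineq4[of "x + (1 / Suc n) *\<^sub>R i" "(1 / Suc n) *\<^sub>R i"] by simp
    moreover have "R \<le> norm x" using that norm_ge_zero[of i] by linarith
    ultimately show ?thesis by (simp add: h_def F0)
  qed
  have "(\<lambda>n. \<integral>x. h n x \<partial>lborel) \<longlonglongrightarrow> (\<integral>x. D x \<partial>lborel)"
  \<comment> \<open>The mean value theorem bounds every quotient by \<open>L\<close>; since the
    increments are at most \<open>norm i\<close> long, the supports stay in one ball.\<close>
  proof (rule integral_dominated_convergence[where w="\<lambda>x. L * indicator (cball 0 (R + norm i)) x"])
    show "integrable lborel (\<lambda>x. L * indicator (cball (0::'a) (R + norm i)) x)"
      using emeasure_lborel_cball_finite by (intro integrable_mult_right integrable_real_indicator) auto
    show "AE x in lborel. norm (h n x) \<le> L * indicator (cball 0 (R + norm i)) x" for n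
      using mvt supp by (auto simp: indicator_def)
    have "(\<lambda>n. h n x) \<longlonglongrightarrow> D x" for x
    proof -
      have "((\<lambda>t. (F (x + (0 + t) *\<^sub>R i) - F (x + 0 *\<^sub>R i)) / t) \<longlongrightarrow> D x) (at 0)"
        using der[of x 0] by (simp add: DERIV_def)
      moreover have "filterlim (\<lambda>n. 1 / real (Suc n)) (at 0) sequentially"
        using LIMSEQ_inverse_real_of_nat by (auto simp: filterlim_at inverse_eq_divide)
      ultimately have "(\<lambda>n. (F (x + (0 + 1 / real (Suc n)) *\<^sub>R i) - F (x + 0 *\<^sub>R i)) / (1 / real (Suc n))) \<longlonglongrightarrow> D x"
        by (rule filterlim_compose)
      then show ?thesis by (simp add: h_def mult.commute)
    qed
    then show "AE x in lborel. (\<lambda>n. h n x) \<longlonglongrightarrow> D x" by simp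
  qed (auto simp: h_def)
  moreover have "(\<integral>x. h n x \<partial>lborel) = 0" for n
  proof -
    have "distr lborel borel (\<lambda>x::'a. (1 / Suc n) *\<^sub>R i + x) = lborel"
      using lborel_distr_plus by blast
    then have *: "integrable lborel (\<lambda>x. F ((1 / Suc n) *\<^sub>R i + x))"
      "(\<integral>x. F ((1 / Suc n) *\<^sub>R i + x) \<partial>lborel) = (\<integral>x. F x \<partial>lborel)"
      using intF integrable_distr_eq[of "\<lambda>x::'a. (1 / Suc n) *\<^sub>R i + x" lborel borel F]
        integral_distr[of "\<lambda>x::'a. (1 / Suc n) *\<^sub>R i + x" lborel borel F] by auto
    then show ?thesis using intF by (simp add: h_def add.commute)
  qed
  ultimately show ?thesis by (simp add: LIMSEQ_const_iff)
qed

text \<open>Integration by parts: the directional derivative of \<open>u * \<phi>\<close>, which has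
  compact support, integrates to 0, and the product rule splits it into the two sides of the
  definition.\<close>

lemma weak_gradient_C1:
  fixes u :: "'a::euclidean_space \<Rightarrow> real"
  assumes der: "\<And>x. (u has_derivative (\<lambda>h. G x \<bullet> h)) (at x)" and cG: "continuous_on UNIV G"
  shows "weak_gradient UNIV u G"
  unfolding weak_gradient_def
proof (intro conjI ballI)
  have cu: "continuous_on UNIV u"
    by (intro continuous_at_imp_continuous_on ballI has_derivative_continuous[OF der])
  have li: "locally_integrable UNIV f" if f: "continuous_on UNIV f" for f :: "'a \<Rightarrow> 'b::euclidean_space"
    unfolding locally_integrable_def
  proof (intro allI impI)
    fix K :: "'a set" assume K: "compact K \<and> K \<subseteq> UNIV"
    then have "integrable lborel (\<lambda>x. indicator K x *\<^sub>R f x)"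
      by (intro borel_integrable_compact continuous_on_subset[OF f]) auto
    then have "integrable lebesgue (\<lambda>x. indicator K x *\<^sub>R f x)"
      using borel_measurable_integrable by (subst integrable_completion) auto
    then show "integrable (lebesgue_on K) f"
      using K by (subst integrable_restrict_space) (auto simp: compact_imp_closed lmeasurable_compact fmeasurableD)
  qed
  show "locally_integrable UNIV u" "locally_integrable UNIV G"
    by (rule li[OF cu], rule li[OF cG])
  fix \<phi> :: "'a \<Rightarrow> real" and i :: 'a
  assume \<phi>: "\<phi> \<in> test_functions UNIV" and i: "i \<in> Basis"
  define d where "d x = frechet_derivative \<phi> (at x) i" for x
  have "Ck (Suc 0) \<phi>" using \<phi> unfolding test_functions_def by blast
  then have diff: "\<phi> differentiable at x" and cd: "continuous_on UNIV d" for x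
    using i by (auto simp: d_def)
  then have d\<phi>: "(\<phi> has_derivative frechet_derivative \<phi> (at x)) (at x)" for x
    by (simp flip: frechet_derivative_works)
  have c\<phi>: "continuous_on UNIV \<phi>"
    by (intro continuous_at_imp_continuous_on ballI has_derivative_continuous[OF d\<phi>])
  have "bounded (closure {x. \<phi> x \<noteq> 0})"
    using \<phi> by (auto simp: test_functions_def compact_imp_bounded)
  then obtain R where R: "\<And>x. x \<in> closure {x. \<phi> x \<noteq> 0} \<Longrightarrow> norm x < R"
    by (meson bounded_pos_less)
  have \<phi>0: "\<phi> x = 0" if "R \<le> norm x" for x
    using R[of x] that closure_subset[of "{x. \<phi> x \<noteq> 0}"] by force
  \<comment> \<open>The closed support lies strictly inside radius \<open>R\<close>, so
    \<open>\<phi>\<close> vanishes in a whole neighbourhood of such a point.\<close>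
  have d0: "d x = 0" if "R \<le> norm x" for x
  proof -
    have "((\<lambda>_. 0) has_derivative (\<lambda>_. 0)) (at x)" by simp
    then have "(\<phi> has_derivative (\<lambda>_. 0)) (at x)"
    proof (rule has_derivative_transform_within_open)
      show "x \<in> - closure {x. \<phi> x \<noteq> 0}" using R[of x] that by auto
      show "0 = \<phi> y" if "y \<in> - closure {x. \<phi> x \<noteq> 0}" for y
        using that closure_subset[of "{x. \<phi> x \<noteq> 0}"] by auto
    qed auto
    from frechet_derivative_at[OF this] show ?thesis by (metis d_def)
  qed
  have cGi: "continuous_on UNIV (\<lambda>x. G x \<bullet> i)" by (intro continuous_intros cG)
  have "(\<integral>x. u x * d x + (G x \<bullet> i) * \<phi> x \<partial>lborel) = 0"
  proof (rule integral_directional_derivative_eq_0[where F="\<lambda>x. u x * \<phi> x" and R=R and i=i])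
    fix x t
    have lin: "((\<lambda>t. x + t *\<^sub>R i) has_derivative (\<lambda>t. t *\<^sub>R i)) (at t)"
      by (auto intro!: derivative_eq_intros)
    have "((\<lambda>t. u (x + t *\<^sub>R i)) has_derivative (\<lambda>h. h * (G (x + t *\<^sub>R i) \<bullet> i))) (at t)"
      using has_derivative_compose[OF lin der] by simp
    then have 1: "((\<lambda>t. u (x + t *\<^sub>R i)) has_real_derivative (G (x + t *\<^sub>R i) \<bullet> i)) (at t)"
      by (simp add: has_field_derivative_def mult_commute_abs)
    have "((\<lambda>t. \<phi> (x + t *\<^sub>R i)) has_derivative (\<lambda>h. h * d (x + t *\<^sub>R i))) (at t)"
      using has_derivative_compose[OF lin d\<phi>]
      by (simp add: d_def linear_cmul[OF has_derivative_linear[OF d\<phi>]])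
    then have 2: "((\<lambda>t. \<phi> (x + t *\<^sub>R i)) has_real_derivative d (x + t *\<^sub>R i)) (at t)"
      by (simp add: has_field_derivative_def mult_commute_abs)
    show "((\<lambda>t. u (x + t *\<^sub>R i) * \<phi> (x + t *\<^sub>R i)) has_real_derivative
        u (x + t *\<^sub>R i) * d (x + t *\<^sub>R i) + G (x + t *\<^sub>R i) \<bullet> i * \<phi> (x + t *\<^sub>R i)) (at t)"
      using DERIV_mult[OF 1 2] by (simp add: algebra_simps)
  qed (auto intro!: continuous_intros cu c\<phi> cd cGi simp: \<phi>0 d0)
  moreover have "integrable lborel (\<lambda>x. u x * d x)" "integrable lborel (\<lambda>x. (G x \<bullet> i) * \<phi> x)"
    by (rule integrable_compact_support[where R=R]; auto intro!: continuous_intros cu c\<phi> cd cGi simp: \<phi>0 d0)+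
  ultimately have "(\<integral>x. u x * d x \<partial>lborel) = - (\<integral>x. (G x \<bullet> i) * \<phi> x \<partial>lborel)"
    by simp
  moreover have "(\<lambda>x. u x * d x) \<in> borel_measurable borel" "(\<lambda>x. (G x \<bullet> i) * \<phi> x) \<in> borel_measurable borel"
    by (auto intro!: borel_measurable_continuous_onI continuous_intros cu c\<phi> cd cGi)
  ultimately show "(\<integral>x. u x * frechet_derivative \<phi> (at x) i \<partial>lebesgue_on UNIV) =
      - (\<integral>x. (G x \<bullet> i) * \<phi> x \<partial>lebesgue_on UNIV)"
    by (simp add: integral_completion lebesgue_on_UNIV_eq d_def)
qed

section \<open>Averages of sequences tending to zero\<close>

text \<open>Let \<open>(1 + d) powr p = 2\<close>. If \<open>a \<le> d * b\<close>, then
  \<open>a + b \<le> (1 + d) * b\<close>; otherwise \<open>b < a / d\<close> and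
  \<open>a + b\<close> is controlled by \<open>a\<close> alone. Only the constant at
  \<open>a\<close> depends on \<open>p\<close>.\<close>

lemma powr_add_le:
  fixes p :: real
  assumes "1 < p"
  obtains C where "0 \<le> C" "\<And>a b. 0 \<le> a \<Longrightarrow> 0 \<le> b \<Longrightarrow> (a + b) powr p \<le> C * a powr p + 2 * b powr p"
proof
  define d :: real where "d = 2 powr (1 / p) - 1"
  have d: "0 < d" using assms by (simp add: d_def)
  show "0 \<le> (1 + 1 / d) powr p" by simp
  fix a b :: real assume ab: "0 \<le> a" "0 \<le> b"
  show "(a + b) powr p \<le> (1 + 1 / d) powr p * a powr p + 2 * b powr p"
  proof (cases "a \<le> d * b")
    case True
    have "(a + b) powr p \<le> ((1 + d) * b) powr p"
      using True ab assms by (intro powr_mono2) (auto simp: algebra_simps)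
    also have "\<dots> = 2 * b powr p"
      using ab d assms by (simp add: powr_mult d_def powr_powr)
    finally show ?thesis by (simp add: add_increasing)
  next
    case False
    then have "(a + b) powr p \<le> ((1 + 1 / d) * a) powr p"
      using d ab assms by (intro powr_mono2) (auto simp: field_simps)
    also have "\<dots> = (1 + 1 / d) powr p * a powr p"
      using ab d assms by (simp add: powr_mult)
    finally show ?thesis by (simp add: add_increasing2)
  qed
qed

text \<open>Adding a far member of a bounded sequence that tends to 0 almost everywhere increases
  the p-th power integral by at most a fixed amount. The gain is additive: the bound
  \<open>B\<close> for \<open>S\<close> keeps the factor 1, so that repeating the step gives linear
  and not exponential growth.\<close>

lemma Brezis_Lieb_bound:
  fixes F :: "nat \<Rightarrow> 'b \<Rightarrow> real"
  assumes p: "1 < p" and [measurable]: "\<And>k. F k \<in> borel_measurable M" "S \<in> borel_measurable M"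
    and nonneg: "\<And>k x. 0 \<le> F k x" "\<And>x. 0 \<le> S x"
    and bd: "\<And>k. (\<integral>\<^sup>+x. ennreal (F k x powr p) \<partial>M) \<le> ennreal A" "0 \<le> A"
    and lim: "AE x in M. (\<lambda>k. F k x) \<longlonglongrightarrow> 0"
    and S: "(\<integral>\<^sup>+x. ennreal (S x powr p) \<partial>M) \<le> ennreal B" "0 \<le> B"
  shows "\<forall>\<^sub>F k in sequentially. (\<integral>\<^sup>+x. ennreal ((S x + F k x) powr p) \<partial>M) \<le> ennreal (B + (2 * A + 1))"
proof -
  obtain C where C: "0 \<le> C" "\<And>a b. 0 \<le> a \<Longrightarrow> 0 \<le> b \<Longrightarrow> (a + b) powr p \<le> C * a powr p + 2 * b powr p"
    using powr_add_le[OF p] by metis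
  \<comment> \<open>Subtracting \<open>2 * F k x powr p\<close> leaves a remainder that is dominated
    by the fixed integrable function \<open>C * S x powr p\<close> and tends to
    \<open>S x powr p\<close>. The subtracted part costs \<open>2 * A\<close>, and the passage from
    the limit to large \<open>k\<close> costs 1.\<close>
  define h where "h k x = max 0 ((S x + F k x) powr p - 2 * F k x powr p)" for k x
  have [measurable]: "h k \<in> borel_measurable M" for k unfolding h_def by measurable
  have "(\<lambda>k. \<integral>\<^sup>+x. ennreal (h k x) \<partial>M) \<longlonglongrightarrow> (\<integral>\<^sup>+x. ennreal (S x powr p) \<partial>M)"
  proof (rule nn_integral_dominated_convergence[where w="\<lambda>x. ennreal (C * S x powr p)"])
    show "AE x in M. ennreal (h k x) \<le> ennreal (C * S x powr p)" for k
    proof (rule AE_I2)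
      fix x
      have "(S x + F k x) powr p \<le> C * S x powr p + 2 * F k x powr p" by (rule C(2)[OF nonneg(2,1)])
      then show "ennreal (h k x) \<le> ennreal (C * S x powr p)" using C(1) by (auto simp: h_def intro!: ennreal_leI)
    qed
    have "(\<integral>\<^sup>+x. ennreal (C * S x powr p) \<partial>M) = ennreal C * (\<integral>\<^sup>+x. ennreal (S x powr p) \<partial>M)"
      using C(1) by (simp add: ennreal_mult nn_integral_cmult)
    also have "\<dots> \<le> ennreal C * ennreal B" by (intro mult_left_mono S) simp
    also have "\<dots> < \<infinity>" using C(1) S(2) by (simp flip: ennreal_mult)
    finally show "(\<integral>\<^sup>+x. ennreal (C * S x powr p) \<partial>M) < \<infinity>" .
    show "AE x in M. (\<lambda>k. ennreal (h k x)) \<longlonglongrightarrow> ennreal (S x powr p)"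
      using lim
    proof eventually_elim
      fix x assume F: "(\<lambda>k. F k x) \<longlonglongrightarrow> 0"
      have "(\<lambda>k. max 0 ((S x + F k x) powr p - 2 * F k x powr p)) \<longlonglongrightarrow> max 0 ((S x + 0) powr p - 2 * 0 powr p)"
        using p nonneg by (intro tendsto_intros F) (auto intro!: tendsto_intros F always_eventually)
      then show "(\<lambda>k. ennreal (h k x)) \<longlonglongrightarrow> ennreal (S x powr p)"
        unfolding h_def by (intro tendsto_ennrealI) simp
    qed
  qed auto
  moreover have "(\<integral>\<^sup>+x. ennreal (S x powr p) \<partial>M) < ennreal (B + 1)"
    using S by (auto intro: le_less_trans ennreal_lessI)
  ultimately have "\<forall>\<^sub>F k in sequentially. (\<integral>\<^sup>+x. ennreal (h k x) \<partial>M) < ennreal (B + 1)"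
    by (rule order_tendstoD)
  then show ?thesis
  proof eventually_elim
    fix k assume hk: "(\<integral>\<^sup>+x. ennreal (h k x) \<partial>M) < ennreal (B + 1)"
    have "(\<integral>\<^sup>+x. ennreal ((S x + F k x) powr p) \<partial>M)
        \<le> (\<integral>\<^sup>+x. ennreal (h k x) + 2 * ennreal (F k x powr p) \<partial>M)"
    proof (rule nn_integral_mono)
      fix x
      have "(S x + F k x) powr p \<le> h k x + 2 * F k x powr p" by (simp add: h_def)
      moreover have "ennreal (h k x + 2 * F k x powr p) = ennreal (h k x) + 2 * ennreal (F k x powr p)"
        by (simp add: ennreal_mult h_def)
      ultimately show "ennreal ((S x + F k x) powr p) \<le> ennreal (h k x) + 2 * ennreal (F k x powr p)"
        by (metis ennreal_leI)
    qed
    also have "\<dots> = (\<integral>\<^sup>+x. ennreal (h k x) \<partial>M) + 2 * (\<integral>\<^sup>+x. ennreal (F k x powr p) \<partial>M)"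
      by (simp add: nn_integral_add nn_integral_cmult)
    also have "\<dots> \<le> ennreal (B + 1) + 2 * ennreal A"
      by (intro add_mono mult_left_mono less_imp_le[OF hk] bd) simp
    also have "\<dots> = ennreal (B + (2 * A + 1))"
      using S(2) bd(2) by (simp add: ennreal_mult ac_simps)
    finally show "(\<integral>\<^sup>+x. ennreal ((S x + F k x) powr p) \<partial>M) \<le> ennreal (B + (2 * A + 1))" .
  qed
qed

text \<open>Choosing the indices one after the other, each far enough out, gives sums of
  \<open>n\<close> terms with p-th power integral at most \<open>n * (2 * A + 1)\<close>. Dividing
  by \<open>n powr p\<close> leaves a multiple of \<open>n powr (1 - p)\<close>, which is small
  because \<open>p > 1\<close>.\<close>

lemma Banach_Saks_averages:
  fixes F :: "nat \<Rightarrow> 'b \<Rightarrow> real"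
  assumes p: "1 < p" and [measurable]: "\<And>k. F k \<in> borel_measurable M"
    and nonneg: "\<And>k x. 0 \<le> F k x"
    and bd: "\<And>k. (\<integral>\<^sup>+x. ennreal (F k x powr p) \<partial>M) \<le> ennreal A" "0 \<le> A"
    and lim: "AE x in M. (\<lambda>k. F k x) \<longlonglongrightarrow> 0"
    and e: "0 < e"
  obtains K where "finite K" "K \<noteq> {}" "K \<subseteq> {k0::nat..}"
    "(\<integral>\<^sup>+x. ennreal ((\<Sum>k\<in>K. F k x / card K) powr p) \<partial>M) \<le> ennreal e"
proof -
  have ex: "\<exists>K\<subseteq>{k0..}. finite K \<and> card K = n \<and>
    (\<integral>\<^sup>+x. ennreal ((\<Sum>k\<in>K. F k x) powr p) \<partial>M) \<le> ennreal (n * (2 * A + 1))" for n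
  proof (induction n)
    case (Suc n)
    then obtain K where K: "K \<subseteq> {k0..}" "finite K" "card K = n"
      "(\<integral>\<^sup>+x. ennreal ((\<Sum>k\<in>K. F k x) powr p) \<partial>M) \<le> ennreal (n * (2 * A + 1))" by blast
    have "\<forall>\<^sub>F k in sequentially. (\<integral>\<^sup>+x. ennreal (((\<Sum>k\<in>K. F k x) + F k x) powr p) \<partial>M)
        \<le> ennreal (n * (2 * A + 1) + (2 * A + 1))"
      using bd(2) K(4) by (intro Brezis_Lieb_bound[OF p _ _ nonneg _ bd lim]) (auto intro: sum_nonneg nonneg)
    \<comment> \<open>The new index must differ from all old ones for the cardinality to grow;
      inserting 0 gives \<open>Max\<close> a nonempty set when \<open>K\<close> is empty.\<close>
    moreover have "\<forall>\<^sub>F k in sequentially. k \<ge> k0 + Suc (Max (insert 0 K))"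
      by (rule eventually_ge_at_top)
    ultimately have "\<forall>\<^sub>F k in sequentially. (\<integral>\<^sup>+x. ennreal (((\<Sum>k\<in>K. F k x) + F k x) powr p) \<partial>M)
        \<le> ennreal (n * (2 * A + 1) + (2 * A + 1)) \<and> k \<ge> k0 + Suc (Max (insert 0 K))"
      by (rule eventually_conj)
    then obtain k where k: "(\<integral>\<^sup>+x. ennreal (((\<Sum>k\<in>K. F k x) + F k x) powr p) \<partial>M)
        \<le> ennreal (n * (2 * A + 1) + (2 * A + 1))" "k \<ge> k0 + Suc (Max (insert 0 K))"
      using eventually_happens'[OF sequentially_bot] by blast
    have "k \<notin> K"
    proof
      assume "k \<in> K"
      then have "k \<le> Max (insert 0 K)" using K(2) by (intro Max_ge) auto
      then show False using k(2) by simp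
    qed
    then show ?case using K k by (intro exI[of _ "insert k K"]) (auto simp: algebra_simps)
  qed (auto intro!: exI[of _ "{}"])
  \<comment> \<open>This is the condition \<open>(2 * A + 1) / n powr (p - 1) \<le> e\<close> solved
    for \<open>n\<close>.\<close>
  obtain n :: nat where n: "max 1 (((2 * A + 1) / e) powr (1 / (p - 1))) \<le> n"
    using real_arch_simple by blast
  then have n1: "1 \<le> n" by simp
  have "(2 * A + 1) / e = (((2 * A + 1) / e) powr (1 / (p - 1))) powr (p - 1)"
    using e bd(2) p by (simp add: powr_powr)
  also have "\<dots> \<le> real n powr (p - 1)"
    using n p by (intro powr_mono2) auto
  finally have ne: "(2 * A + 1) / e \<le> real n powr (p - 1)" .
  obtain K where K: "K \<subseteq> {k0..}" "finite K" "card K = n"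
      "(\<integral>\<^sup>+x. ennreal ((\<Sum>k\<in>K. F k x) powr p) \<partial>M) \<le> ennreal (n * (2 * A + 1))"
    using ex[of n] by blast
  have "(\<integral>\<^sup>+x. ennreal ((\<Sum>k\<in>K. F k x / card K) powr p) \<partial>M)
      = (\<integral>\<^sup>+x. ennreal (n powr - p) * ennreal ((\<Sum>k\<in>K. F k x) powr p) \<partial>M)"
    using n1 K(3)
    by (intro nn_integral_cong) (simp add: sum_divide_distrib[symmetric] powr_divide sum_nonneg nonneg powr_minus divide_simps flip: ennreal_mult)
  also have "\<dots> = ennreal (n powr - p) * (\<integral>\<^sup>+x. ennreal ((\<Sum>k\<in>K. F k x) powr p) \<partial>M)"
    by (simp add: nn_integral_cmult)
  also have "\<dots> \<le> ennreal (n powr - p) * ennreal (n * (2 * A + 1))"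
    by (intro mult_left_mono K) simp
  also have "\<dots> = ennreal ((2 * A + 1) / n powr (p - 1))"
    using n1 by (simp add: powr_diff powr_minus field_simps flip: ennreal_mult')
  also have "\<dots> \<le> ennreal e"
    using ne e n1 by (intro ennreal_leI) (simp add: field_simps)
  finally show ?thesis using K n1 that by force
qed

text \<open>Dyadic decomposition: the contributions of the shells form geometric series, with ratio
  \<open>2 powr - (p - s * p)\<close> towards the origin, where \<open>s < 1\<close> is used, and
  \<open>2 powr - (s * p)\<close> towards infinity, where \<open>s > 0\<close> is used.\<close>

lemma fractional_kernel_integrable:
  assumes "0 < s" "s < 1" "0 < p"
  shows "(\<integral>\<^sup>+h. ennreal ((min 1 (norm h)) powr p / norm (h::'a::euclidean_space) powr (real DIM('a) + s * p)) \<partial>lborel) < \<infinity>"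
proof -
  define N where "N = real DIM('a)"
  define V where "V = measure lborel (ball (0::'a) 1)"
  define a where "a = N + s * p"
  have a0: "0 \<le> a" using assms by (simp add: a_def N_def)
  \<comment> \<open>\<open>A k\<close> majorizes the kernel on the shell where \<open>norm h\<close>
    lies between \<open>2 powr - (k + 1)\<close> and \<open>2 powr - k\<close>, and
    \<open>B k\<close> on the shell between \<open>2 powr k\<close> and
    \<open>2 powr (k + 1)\<close>. Whole balls replace the shells, with radii written as reciprocals
    to fit \<open>emeasure_lborel_ball_scale\<close>.\<close>
  define A where "A k h = ennreal (2 powr a * 2 powr ((a - p) * real k)) * indicator (ball (0::'a) (1 / 2 powr real k)) h" for k :: nat and h
  define B where "B k h = ennreal (2 powr (- a * real k)) * indicator (ball (0::'a) (1 / 2 powr (- (real k + 1)))) h" for k :: nat and h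
  have [measurable]: "A k \<in> borel_measurable borel" "B k \<in> borel_measurable borel" for k
    unfolding A_def B_def by (intro borel_measurable_times_ennreal borel_measurable_const borel_measurable_indicator; simp)+
  have V0: "0 \<le> V" by (simp add: V_def)
  have le: "ennreal ((min 1 (norm h)) powr p / norm h powr a) \<le> (\<Sum>k. A k h) + (\<Sum>k. B k h)" for h :: 'a
  proof (cases "h = 0")
    case False
    define t where "t = log 2 (norm h)"
    have nh: "norm h = 2 powr t" using False by (simp add: t_def)
    \<comment> \<open>\<open>n\<close> is the dyadic level of \<open>h\<close>; its sign decides
      between the \<open>B\<close> series and the \<open>A\<close> series.\<close>
    define n where "n = \<lfloor>t\<rfloor>"
    have n: "real_of_int n \<le> t" "t < real_of_int n + 1" by (simp_all add: n_def)
    show ?thesis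
    proof (cases "0 \<le> n")
      case True
      define k where "k = nat n"
      have k: "real k \<le> t" "t < real k + 1" using n True by (simp_all add: k_def)
      have "ennreal ((min 1 (norm h)) powr p / norm h powr a) \<le> ennreal (1 / norm h powr a)"
        using assms by (intro ennreal_leI divide_right_mono powr_le1) auto
      also have "\<dots> = ennreal (2 powr (- a * t))"
        by (simp add: nh powr_powr powr_minus divide_simps mult.commute)
      also have "\<dots> \<le> ennreal (2 powr (- a * real k))"
        using k a0 by (intro ennreal_leI powr_mono) (auto intro: mult_left_mono)
      also have "\<dots> = B k h"
      proof -
        have "1 / 2 powr (- (real k + 1)) = (2::real) powr (real k + 1)"
          by (simp only: powr_minus inverse_eq_divide) simp
        then have "h \<in> ball 0 (1 / 2 powr (- (real k + 1)))"
          using k(2) by (simp only: mem_ball dist_0_norm nh) simp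
        then show ?thesis by (simp only: B_def indicator_simps mult_1_right)
      qed
      also have "\<dots> \<le> (\<Sum>k. B k h)"
        using sum_le_suminf[of "\<lambda>k. B k h" "{k}"] by simp
      finally show ?thesis by (simp add: add_increasing)
    next
      case False
      define k where "k = nat (- n - 1)"
      have k: "- (real k + 1) \<le> t" "t < - real k" using n False by (simp_all add: k_def)
      have "(min 1 (norm h)) powr p / norm h powr a \<le> (norm h) powr p / norm h powr a"
        using assms by (intro divide_right_mono powr_mono2) auto
      also have "\<dots> = 2 powr (p * t) * 2 powr (- a * t)"
        by (simp add: nh powr_powr powr_minus divide_simps mult.commute)
      also have "\<dots> \<le> 2 powr (p * - real k) * 2 powr (a * (real k + 1))"
      proof -
        have "p * t \<le> p * - real k" using k assms by (intro mult_left_mono) auto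
        moreover have "- a * t \<le> a * (real k + 1)" using k a0 mult_left_mono[of "- t" "real k + 1" a] by simp
        ultimately show ?thesis by (intro mult_mono) auto
      qed
      also have "\<dots> = 2 powr a * 2 powr ((a - p) * real k)"
        by (simp add: algebra_simps flip: powr_add)
      finally have "ennreal ((min 1 (norm h)) powr p / norm h powr a) \<le> ennreal (2 powr a * 2 powr ((a - p) * real k))"
        by (rule ennreal_leI)
      also have "\<dots> = A k h"
      proof -
        have "1 / 2 powr real k = (2::real) powr (- real k)"
          by (simp only: powr_minus inverse_eq_divide)
        then have "h \<in> ball 0 (1 / 2 powr real k)"
          using k(2) by (simp only: mem_ball dist_0_norm nh) simp
        then show ?thesis by (simp only: A_def indicator_simps mult_1_right)
      qed
      also have "\<dots> \<le> (\<Sum>k. A k h)"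
        using sum_le_suminf[of "\<lambda>k. A k h" "{k}"] by simp
      finally show ?thesis by (simp add: add_increasing2)
    qed
  qed simp
  have geom: "(\<Sum>k. ennreal (c * 2 powr (- d * real k))) < \<infinity>" if "0 \<le> c" "0 < d" for c d
  proof -
    have "(\<lambda>k. (2 powr - d) ^ k) sums (1 / (1 - 2 powr - d))"
      using that powr_less_mono[of "- d" 0 2] by (intro geometric_sums) simp
    moreover have "(2 powr - d) ^ k = 2 powr (- d * real k)" for k
      by (simp add: powr_powr flip: powr_realpow)
    ultimately have "(\<lambda>k. c * 2 powr (- d * real k)) sums (c * (1 / (1 - 2 powr - d)))"
      by (intro sums_mult) simp
    from suminf_ennreal_eq[OF _ this] have "(\<Sum>k. ennreal (c * 2 powr (- d * real k))) = ennreal (c * (1 / (1 - 2 powr - d)))"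
      using that(1) by (metis mult_nonneg_nonneg powr_ge_zero)
    then show ?thesis by (metis ennreal_less_top infinity_ennreal_def)
  qed
  have "(\<integral>\<^sup>+h. A k h \<partial>lborel) = ennreal (2 powr a * V * 2 powr (- (p - s * p) * real k))" for k
  proof -
    have "(\<integral>\<^sup>+h. A k h \<partial>lborel) = ennreal (2 powr a * 2 powr ((a - p) * real k)) * ennreal ((2 powr real k) powr - N * V)"
      unfolding A_def V_def N_def by (subst nn_integral_cmult_indicator, simp, subst emeasure_lborel_ball_scale) simp_all
    also have "\<dots> = ennreal (2 powr a * V * (2 powr ((a - p) * real k) * 2 powr (- N * real k)))"
      using V0 by (simp add: powr_powr mult_ac flip: ennreal_mult)
    also have "2 powr ((a - p) * real k) * 2 powr (- N * real k) = 2 powr (- (p - s * p) * real k)"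
      unfolding powr_add[symmetric] by (simp add: a_def algebra_simps)
    finally show ?thesis .
  qed
  moreover have "(\<integral>\<^sup>+h. (\<Sum>k. A k h) \<partial>lborel) = (\<Sum>k. \<integral>\<^sup>+h. A k h \<partial>lborel)"
    by (intro nn_integral_suminf) simp
  ultimately have "(\<integral>\<^sup>+h. (\<Sum>k. A k h) \<partial>lborel) = (\<Sum>k. ennreal (2 powr a * V * 2 powr (- (p - s * p) * real k)))"
    by (simp only:)
  also have "\<dots> < \<infinity>" using V0 assms by (intro geom) auto
  finally have iA: "(\<integral>\<^sup>+h. (\<Sum>k. A k h) \<partial>lborel) < \<infinity>" .
  have "(\<integral>\<^sup>+h. B k h \<partial>lborel) = ennreal (2 powr N * V * 2 powr (- (s * p) * real k))" for k
  proof -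
    have "(\<integral>\<^sup>+h. B k h \<partial>lborel) = ennreal (2 powr (- a * real k)) * ennreal ((2 powr (- (real k + 1))) powr - N * V)"
      unfolding B_def V_def N_def by (subst nn_integral_cmult_indicator, simp, subst emeasure_lborel_ball_scale) simp_all
    also have "(2 powr (- (real k + 1))) powr - N = 2 powr (N * (real k + 1))"
      by (simp add: powr_powr algebra_simps)
    also have "ennreal (2 powr (- a * real k)) * ennreal (2 powr (N * (real k + 1)) * V)
        = ennreal (V * (2 powr (- a * real k) * 2 powr (N * (real k + 1))))"
      using V0 by (simp add: mult_ac flip: ennreal_mult)
    also have "2 powr (- a * real k) * 2 powr (N * (real k + 1)) = 2 powr N * 2 powr (- (s * p) * real k)"
      unfolding powr_add[symmetric] by (simp add: a_def algebra_simps)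
    finally show ?thesis by (simp add: mult_ac)
  qed
  moreover have "(\<integral>\<^sup>+h. (\<Sum>k. B k h) \<partial>lborel) = (\<Sum>k. \<integral>\<^sup>+h. B k h \<partial>lborel)"
    by (intro nn_integral_suminf) simp
  ultimately have "(\<integral>\<^sup>+h. (\<Sum>k. B k h) \<partial>lborel) = (\<Sum>k. ennreal (2 powr N * V * 2 powr (- (s * p) * real k)))"
    by (simp only:)
  also have "\<dots> < \<infinity>" using V0 assms by (intro geom) auto
  finally have iB: "(\<integral>\<^sup>+h. (\<Sum>k. B k h) \<partial>lborel) < \<infinity>" .
  have "(\<integral>\<^sup>+h. ennreal ((min 1 (norm (h::'a))) powr p / norm h powr a) \<partial>lborel)
      \<le> (\<integral>\<^sup>+h. (\<Sum>k. A k h) + (\<Sum>k. B k h) \<partial>lborel)"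
    by (intro nn_integral_mono le)
  also have "\<dots> = (\<integral>\<^sup>+h. (\<Sum>k. A k h) \<partial>lborel) + (\<integral>\<^sup>+h. (\<Sum>k. B k h) \<partial>lborel)"
    by (intro nn_integral_add) auto
  also have "\<dots> < \<infinity>" using iA iB by simp
  finally show ?thesis by (simp add: a_def N_def)
qed

section \<open>The Gagliardo integral of the bump function\<close>

text \<open>The device for evaluating objects known only almost everywhere: a nonempty open set is
  not negligible, so it contains a good point.\<close>

lemma AE_lebesgue_open_ex:
  fixes U :: "'a::euclidean_space set"
  assumes "AE x in lebesgue. P x" "open U" "U \<noteq> {}"
  shows "\<exists>x\<in>U. P x"
proof (rule ccontr)
  assume "\<not> ?thesis"
  moreover obtain Z where "Z \<in> null_sets lebesgue" "{x \<in> space lebesgue. \<not> P x} \<subseteq> Z"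
    using assms(1) by (auto simp: eventually_ae_filter)
  ultimately have "negligible Z" "U \<subseteq> Z" by (auto simp: negligible_iff_null_sets)
  then show False using open_not_negligible[OF assms(2,3)] negligible_subset by blast
qed

text \<open>The bare double integral in iterated Borel form, so that dilations can be carried out in
  one variable at a time.\<close>

definition gagliardo_integral :: "real \<Rightarrow> real \<Rightarrow> ('a::euclidean_space \<Rightarrow> real) \<Rightarrow> ennreal" where
  "gagliardo_integral s p u = (\<integral>\<^sup>+x. \<integral>\<^sup>+y. ennreal (\<bar>u x - u y\<bar> powr p /
     norm (x - y) powr (real DIM('a) + s * p)) \<partial>lborel \<partial>lborel)"

lemma gagliardo_integrand_measurable[measurable]:
  fixes u :: "'a::euclidean_space \<Rightarrow> real"
  assumes [measurable]: "u \<in> borel_measurable borel"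
  shows "(\<lambda>z. ennreal (\<bar>u (fst z) - u (snd z)\<bar> powr p / norm (fst z - snd z) powr a)) \<in> borel_measurable borel"
proof -
  have [measurable]: "fst \<in> borel_measurable (borel :: ('a \<times> 'a) measure)"
    "snd \<in> borel_measurable (borel :: ('a \<times> 'a) measure)"
    by (auto intro!: borel_measurable_continuous_onI continuous_intros)
  show ?thesis by measurable
qed

lemma gagliardo_eq:
  fixes u :: "'a::euclidean_space \<Rightarrow> real"
  assumes "u \<in> borel_measurable borel"
  shows "gagliardo UNIV s p u =
    ennreal_powr (ennreal (c_const DIM('a) s p) * gagliardo_integral s p u) (1 / p)"
  using nn_integral_lebesgue_pair[OF gagliardo_integrand_measurable[OF assms, of p "real DIM('a) + s * p"]]
  by (simp add: gagliardo_def gagliardo_integral_def lebesgue_on_UNIV_eq case_prod_unfold)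

text \<open>Both Gamma arguments are positive: \<open>p + N - 2 \<ge> 0\<close> and
  \<open>p * s > 0\<close> for one, \<open>s < 1\<close> for the other.\<close>

lemma c_const_pos:
  assumes "0 < s" "s < 1" "1 \<le> p" "1 \<le> N"
  shows "0 < c_const N s p"
proof -
  have "0 < p * s" using assms by simp
  moreover have "0 \<le> p + real N - 2" using assms by simp
  ultimately have "0 < Gamma ((p * s + p + real N - 2) / 2)" by (intro Gamma_real_pos) simp
  moreover have "0 < Gamma (1 - s)" using assms by (intro Gamma_real_pos) simp
  ultimately show ?thesis using assms by (simp add: c_const_def)
qed

text \<open>The kernel contributes \<open>m powr (N + s * p)\<close>, and each of the two
  integrations \<open>m powr - N\<close>. At \<open>s * p = N\<close> the factor is 1.\<close>

lemma gagliardo_integral_bump_scale: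
  assumes m: "0 < m"
  shows "gagliardo_integral s p (bump m :: 'a::euclidean_space \<Rightarrow> real) =
    ennreal (m powr (s * p - real DIM('a))) * gagliardo_integral s p (bump 1 :: 'a \<Rightarrow> real)"
proof -
  define N where "N = real DIM('a)"
  define g where "g x y = ennreal (\<bar>bump 1 x - bump 1 y\<bar> powr p / norm (x - y) powr (N + s * p))" for x y :: 'a
  define J where "J = (\<integral>\<^sup>+x. \<integral>\<^sup>+y. g x y \<partial>lborel \<partial>lborel)"
  have J: "J = gagliardo_integral s p (bump 1 :: 'a \<Rightarrow> real)"
    by (simp add: J_def gagliardo_integral_def g_def N_def)
  have gm: "(\<lambda>z. g (fst z) (snd z)) \<in> borel_measurable (borel \<Otimes>\<^sub>M borel)"
    unfolding g_def borel_prod by measurable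
  have g1: "g x \<in> borel_measurable borel" for x
    unfolding g_def by measurable
  have g2: "(\<lambda>x. \<integral>\<^sup>+y. g x y \<partial>lborel) \<in> borel_measurable borel"
    using lborel.borel_measurable_nn_integral_fst[of "\<lambda>z. g (fst z) (snd z)" borel] gm by simp
  have g2m: "(\<lambda>x. \<integral>\<^sup>+y. g (m *\<^sub>R x) y \<partial>lborel) \<in> borel_measurable lborel"
    by (rule measurable_compose[where f="\<lambda>x. m *\<^sub>R x", OF _ g2]) simp
  have g3: "(\<integral>\<^sup>+x. \<integral>\<^sup>+y. g (m *\<^sub>R x) y \<partial>lborel \<partial>lborel) =
      ennreal (m powr - N) * J"
    unfolding N_def J_def by (rule nn_integral_lborel_scale[OF g2 m])
  have "ennreal (\<bar>bump m x - bump m y\<bar> powr p / norm (x - y) powr (N + s * p)) =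
      ennreal (m powr (N + s * p)) * g (m *\<^sub>R x) (m *\<^sub>R y)" for x y :: 'a
    using m by (subst (1 2) bump_scale)
      (simp add: g_def powr_mult flip: ennreal_mult scaleR_diff_right)
  then have "gagliardo_integral s p (bump m :: 'a \<Rightarrow> real) =
      (\<integral>\<^sup>+x. \<integral>\<^sup>+y. ennreal (m powr (N + s * p)) * g (m *\<^sub>R x) (m *\<^sub>R y) \<partial>lborel \<partial>lborel)"
    by (simp add: gagliardo_integral_def N_def)
  also have "\<dots> = (\<integral>\<^sup>+x. ennreal (m powr (N + s * p)) * (ennreal (m powr - N) * (\<integral>\<^sup>+y. g (m *\<^sub>R x) y \<partial>lborel)) \<partial>lborel)"
    unfolding N_def using g1 by (intro nn_integral_cong)
      (simp add: nn_integral_cmult nn_integral_lborel_scale[OF g1 m] measurable_compose[OF _ g1])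
  also have "\<dots> = ennreal (m powr (N + s * p)) * (ennreal (m powr - N) * (\<integral>\<^sup>+x. \<integral>\<^sup>+y. g (m *\<^sub>R x) y \<partial>lborel \<partial>lborel))"
    using g2m by (simp add: nn_integral_cmult)
  also have "\<dots> = ennreal (m powr (N + s * p)) * (ennreal (m powr - N) * (ennreal (m powr - N) * J))"
    unfolding g3 ..
  also have "\<dots> = ennreal (m powr (N + s * p) * (m powr - N * m powr - N)) * J"
    by (simp add: ennreal_mult mult.assoc)
  also have "m powr (N + s * p) * (m powr - N * m powr - N) = m powr (s * p - N)"
    by (simp only: powr_add[symmetric]) simp
  finally show ?thesis by (simp only: N_def J)
qed

text \<open>The integrand vanishes unless one of the two points lies in the unit ball. In that case
  it is at most \<open>4 powr p * k (x - y)\<close> with an integrable kernel \<open>k\<close>, so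
  the double integral is bounded by the volume of the ball times the integral of \<open>k\<close>,
  once for each point.\<close>

lemma gagliardo_integral_bump_finite:
  assumes s: "0 < s" "s < 1" "0 < p"
  shows "gagliardo_integral s p (bump 1 :: 'a::euclidean_space \<Rightarrow> real) < \<infinity>"
proof -
  define N where "N = real DIM('a)"
  define k where "k h = ennreal ((min 1 (norm h)) powr p / norm h powr (N + s * p))" for h :: 'a
  define I where "I = (\<integral>\<^sup>+h. k h \<partial>lborel)"
  define B where "B = ball (0::'a) 1"
  have [measurable]: "k \<in> borel_measurable borel" unfolding k_def by measurable
  have [measurable]: "B \<in> sets borel" by (simp add: B_def)
  \<comment> \<open>The reflection \<open>x - y\<close> is the reason why the affine substitution
    rule admits a negative factor.\<close>
  have sh: "(\<integral>\<^sup>+y. k (x - y) \<partial>lborel) = I" for x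
    using nn_integral_lborel_affine[of k "-1" x] by (simp add: I_def)
  have sh': "(\<integral>\<^sup>+x. k (x - y) \<partial>lborel) = I" for y
    using nn_integral_lborel_affine[of k 1 "- y"] by (simp add: I_def)
  have le: "ennreal (\<bar>bump 1 x - bump 1 y\<bar> powr p / norm (x - y) powr (N + s * p)) \<le>
      ennreal (4 powr p) * (indicator B x * k (x - y) + indicator B y * k (x - y))" for x y :: 'a
  proof (cases "x \<in> B \<or> y \<in> B")
    case True
    have "\<bar>bump 1 x - bump 1 y\<bar> \<le> 1"
      using bump_nonneg[of 1 x] bump_nonneg[of 1 y] bump_le_1[of 1 x] bump_le_1[of 1 y] by linarith
    then have "\<bar>bump 1 x - bump 1 y\<bar> \<le> 4 * min 1 (norm (x - y))"
      using bump_lipschitz[of x y] by (simp add: min_def)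
    then have "\<bar>bump 1 x - bump 1 y\<bar> powr p \<le> (4 * min 1 (norm (x - y))) powr p"
      using s by (intro powr_mono2) auto
    then have "\<bar>bump 1 x - bump 1 y\<bar> powr p / norm (x - y) powr (N + s * p)
        \<le> 4 powr p * (min 1 (norm (x - y)) powr p / norm (x - y) powr (N + s * p))"
      by (simp add: powr_mult divide_right_mono)
    then have "ennreal (\<bar>bump 1 x - bump 1 y\<bar> powr p / norm (x - y) powr (N + s * p)) \<le> ennreal (4 powr p) * k (x - y)"
      by (simp add: k_def ennreal_leI flip: ennreal_mult)
    also have "\<dots> \<le> ennreal (4 powr p) * (indicator B x * k (x - y) + indicator B y * k (x - y))"
      using True by (intro mult_left_mono) (auto simp: indicator_def)
    finally show ?thesis .
  next
    case False
    then have "bump 1 x = 0" "bump 1 y = 0" by (auto simp: B_def bump_eq_0)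
    then show ?thesis using s by simp
  qed
  have [measurable]: "fst \<in> borel_measurable (borel :: ('a \<times> 'a) measure)"
    "snd \<in> borel_measurable (borel :: ('a \<times> 'a) measure)"
    by (auto intro!: borel_measurable_continuous_onI continuous_intros)
  have m2: "(\<lambda>z. indicator B (snd z) * k (fst z - snd z)) \<in> borel_measurable (lborel \<Otimes>\<^sub>M lborel)"
    unfolding lborel_prod by measurable
  have i1: "(\<integral>\<^sup>+x. \<integral>\<^sup>+y. indicator B x * k (x - y) \<partial>lborel \<partial>lborel) = emeasure lborel B * I"
    by (simp add: nn_integral_cmult sh nn_integral_multc)
  \<comment> \<open>Here the cut-off sits on the inner variable, so the order of integration is
    exchanged first.\<close>
  have i2: "(\<integral>\<^sup>+x. \<integral>\<^sup>+y. indicator B y * k (x - y) \<partial>lborel \<partial>lborel) = emeasure lborel B * I"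
    using lborel_pair.Fubini[OF m2] by (simp add: nn_integral_cmult sh' nn_integral_multc)
  have mm: "(\<lambda>x. \<integral>\<^sup>+y. indicator B x * k (x - y) \<partial>lborel) \<in> borel_measurable lborel"
    "(\<lambda>x. \<integral>\<^sup>+y. indicator B y * k (x - y) \<partial>lborel) \<in> borel_measurable lborel"
    using lborel.borel_measurable_nn_integral_fst[OF m2] by (simp_all add: nn_integral_cmult sh)
  have "gagliardo_integral s p (bump 1 :: 'a \<Rightarrow> real) \<le> (\<integral>\<^sup>+x. \<integral>\<^sup>+y. ennreal (4 powr p) * (indicator B x * k (x - y) + indicator B y * k (x - y)) \<partial>lborel \<partial>lborel)"
    using le unfolding gagliardo_integral_def N_def by (intro nn_integral_mono) simp
  also have "\<dots> = (\<integral>\<^sup>+x. ennreal (4 powr p) * (indicator B x * I + (\<integral>\<^sup>+y. indicator B y * k (x - y) \<partial>lborel)) \<partial>lborel)"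
    by (simp add: nn_integral_cmult nn_integral_add sh)
  also have "\<dots> = ennreal (4 powr p) * (emeasure lborel B * I + emeasure lborel B * I)"
    using mm(2) by (simp add: nn_integral_cmult nn_integral_add nn_integral_multc i2)
  also have "\<dots> < \<infinity>"
  proof -
    have "I < \<infinity>" using fractional_kernel_integrable[OF s, where 'a='a] by (simp add: I_def k_def N_def)
    moreover have "emeasure lborel B < \<infinity>" using emeasure_lborel_ball_finite by (simp add: B_def)
    ultimately show ?thesis by (simp add: ennreal_mult_less_top)
  qed
  finally show ?thesis .
qed

text \<open>A zero integral would make the integrand vanish almost everywhere, hence at some pair
  with one point inside and one outside the closed unit ball. There the two bump values
  differ.\<close>

lemma gagliardo_integral_bump_pos:
  "0 < gagliardo_integral s p (bump 1 :: 'a::euclidean_space \<Rightarrow> real)"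
proof (rule ccontr)
  assume "\<not> ?thesis"
  then have z: "gagliardo_integral s p (bump 1 :: 'a \<Rightarrow> real) = 0" by (simp add: not_gr_zero)
  define g where "g z = ennreal (\<bar>bump 1 (fst z) - bump 1 (snd z)\<bar> powr p / norm (fst z - snd z) powr (real DIM('a) + s * p))" for z :: "'a \<times> 'a"
  have [measurable]: "g \<in> borel_measurable borel" unfolding g_def by measurable
  have "(\<integral>\<^sup>+z. g z \<partial>lborel) = 0"
    using z by (subst nn_integral_lborel_pair) (auto simp: g_def gagliardo_integral_def)
  then have AE: "AE z in lborel. g z = 0" by (simp add: nn_integral_0_iff_AE)
  define U where "U = ball (0::'a) 1 \<times> (- cball (0::'a) 1)"
  have "open U" by (auto simp: U_def intro!: open_Times)
  moreover have "U \<noteq> {}"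
  proof -
    obtain b :: 'a where "b \<in> Basis" using nonempty_Basis by blast
    then have "(0, 2 *\<^sub>R b) \<in> U" by (simp add: U_def)
    then show ?thesis by blast
  qed
  ultimately have "\<exists>z\<in>U. g z = 0"
    using AE by (intro AE_lebesgue_open_ex) (simp_all add: AE_completion_iff)
  then obtain x y :: 'a where xy: "norm x < 1" "1 < norm y" "g (x, y) = 0" by (auto simp: U_def not_le)
  then have "0 < bump 1 x" "bump 1 y = 0" "x \<noteq> y" using bump_pos[of 1 x] bump_eq_0[of 1 y] by auto
  with xy(3) show False by (simp add: g_def)
qed

section \<open>Bounds for an embedding of a critical space\<close>

lemma Lp_norm_eq:
  fixes u :: "'a::euclidean_space \<Rightarrow> real"
  shows "Lp_norm UNIV (ereal p) u = ennreal_powr (\<integral>\<^sup>+x. ennreal (\<bar>u x\<bar> powr p) \<partial>lborel) (1 / p)"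
  by (simp add: Lp_norm_def lebesgue_on_UNIV_eq nn_integral_completion)

lemma Lp_norm_le_sobolev_norm:
  assumes "1 \<le> q"
  shows "Lp_norm \<Omega> (ereal q) u \<le> sobolev_norm \<Omega> s' (ereal q) u"
proof (cases "s' = 0")
  case False
  have "Lp_norm \<Omega> (ereal q) u = ennreal_powr (ennreal_powr (Lp_norm \<Omega> (ereal q) u) q) (1 / q)"
    using assms by (simp add: ennreal_powr_inverse)
  also have "\<dots> \<le> sobolev_norm \<Omega> s' (ereal q) u"
    using assms False by (auto simp: sobolev_norm_def intro!: ennreal_powr_mono)
  finally show ?thesis .
qed (simp add: sobolev_norm_def)

lemma sobolev_seminorm_le_sobolev_norm:
  assumes "1 \<le> q" "s' \<noteq> 0"
  shows "sobolev_seminorm \<Omega> s' q u \<le> sobolev_norm \<Omega> s' (ereal q) u"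
proof -
  have "sobolev_seminorm \<Omega> s' q u = ennreal_powr (ennreal_powr (sobolev_seminorm \<Omega> s' q u) q) (1 / q)"
    using assms by (simp add: ennreal_powr_inverse)
  also have "\<dots> \<le> sobolev_norm \<Omega> s' (ereal q) u"
    using assms by (auto simp: sobolev_norm_def intro!: ennreal_powr_mono)
  finally show ?thesis .
qed

text \<open>Both parts of the source norm are given by bounds on their p-th powers, because those
  are what add up in the norm. Finite bounds also give membership in the source space.\<close>

lemma embedding_bound:
  assumes emb: "continuously_embedded (UNIV :: 'a::euclidean_space set) s (ereal p) s' p'"
    and "1 \<le> p" "0 < s"
  obtains C where "0 \<le> C"
    "\<And>(u :: 'a \<Rightarrow> real) a b. \<lbrakk>u \<in> borel_measurable borel; 0 \<le> a; 0 \<le> b;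
       sobolev_seminorm UNIV s p u \<le> ennreal (a powr (1 / p));
       (\<integral>\<^sup>+x. ennreal (\<bar>u x\<bar> powr p) \<partial>lborel) \<le> ennreal b\<rbrakk>
     \<Longrightarrow> sobolev_norm UNIV s' p' u \<le> ennreal (C * (a + b) powr (1 / p))"
proof -
  obtain C :: real where C: "\<And>u :: 'a \<Rightarrow> real. u \<in> sobolev_space UNIV s (ereal p) \<Longrightarrow>
      sobolev_norm UNIV s' p' u \<le> ennreal C * sobolev_norm UNIV s (ereal p) u"
    using emb by (auto simp: continuously_embedded_def)
  show ?thesis
  \<comment> \<open>The constant in the definition may be negative, in which case
    \<open>ennreal C\<close> is 0.\<close>
  proof (rule that[of "max 0 C"])
    fix u :: "'a \<Rightarrow> real" and a b :: real
    assume u: "u \<in> borel_measurable borel" and ab: "0 \<le> a" "0 \<le> b"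
      and a: "sobolev_seminorm UNIV s p u \<le> ennreal (a powr (1 / p))"
      and b: "(\<integral>\<^sup>+x. ennreal (\<bar>u x\<bar> powr p) \<partial>lborel) \<le> ennreal b"
    have L: "Lp_norm UNIV (ereal p) u \<le> ennreal (b powr (1 / p))"
      using ennreal_powr_mono[OF b, of "1 / p"] assms ab by (simp add: Lp_norm_eq ennreal_powr_ennreal)
    have "u \<in> borel_measurable lebesgue" using u by (simp add: measurable_completion)
    then have "u \<in> sobolev_space UNIV s (ereal p)"
      using L a by (auto simp: sobolev_space_def Lp_space_def lebesgue_on_UNIV_eq intro: le_less_trans)
    then have "sobolev_norm UNIV s' p' u \<le> ennreal C * sobolev_norm UNIV s (ereal p) u" by (rule C)
    also have "sobolev_norm UNIV s (ereal p) u \<le> ennreal ((a + b) powr (1 / p))"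
    proof -
      have "ennreal_powr (sobolev_seminorm UNIV s p u) p \<le> ennreal a"
        using ennreal_powr_mono[OF a, of p] assms ab by (simp add: ennreal_powr_ennreal powr_powr)
      moreover have "ennreal_powr (Lp_norm UNIV (ereal p) u) p \<le> ennreal b"
        using ennreal_powr_mono[OF L, of p] assms ab by (simp add: ennreal_powr_ennreal powr_powr)
      ultimately have "ennreal_powr (sobolev_seminorm UNIV s p u) p + ennreal_powr (Lp_norm UNIV (ereal p) u) p
          \<le> ennreal (a + b)" using ab by (simp add: add_mono)
      then have "sobolev_norm UNIV s (ereal p) u \<le> ennreal_powr (ennreal (a + b)) (1 / p)"
        using assms by (simp add: sobolev_norm_def ennreal_powr_mono del: ennreal_plus)
      then show ?thesis using ab by (simp add: ennreal_powr_ennreal del: ennreal_plus)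
    qed
    also have "ennreal C * ennreal ((a + b) powr (1 / p)) \<le> ennreal (max 0 C * (a + b) powr (1 / p))"
      by (cases "0 \<le> C") (simp_all add: ennreal_mult max_def ennreal_neg)
    finally show "sobolev_norm UNIV s' p' u \<le> ennreal (max 0 C * (a + b) powr (1 / p))"
      by (simp add: mult_left_mono)
  qed simp
qed

lemma sobolev_seminorm_1_le:
  fixes u :: "'a::euclidean_space \<Rightarrow> real"
  assumes "\<And>x. (u has_derivative (\<lambda>h. G x \<bullet> h)) (at x)" "continuous_on UNIV G"
  shows "sobolev_seminorm UNIV 1 p u \<le> ennreal_powr (\<integral>\<^sup>+x. ennreal (norm (G x) powr p) \<partial>lborel) (1 / p)"
proof -
  have "sobolev_seminorm UNIV 1 p u \<le> Lp_norm UNIV (ereal p) (\<lambda>x. norm (G x))"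
    using weak_gradient_C1[OF assms] by (auto simp: sobolev_seminorm_def intro: INF_lower)
  then show ?thesis by (simp add: Lp_norm_eq)
qed

text \<open>The exact value is recorded because it serves as an upper bound in the source and as a
  lower bound in the target; for the latter \<open>B > 0\<close> matters.\<close>

lemma nn_integral_bump_powr:
  assumes "0 < q"
  obtains B where "0 < B" "\<And>m. 0 < m \<Longrightarrow>
    (\<integral>\<^sup>+x. ennreal (\<bar>bump m (x::'a)\<bar> powr q) \<partial>lborel) = ennreal (B * m powr - real DIM('a::euclidean_space))"
proof -
  define I where "I = (\<integral>\<^sup>+x. ennreal (\<bar>bump 1 (x::'a)\<bar> powr q) \<partial>lborel)"
  have m: "(\<integral>\<^sup>+x. ennreal (\<bar>bump m (x::'a)\<bar> powr q) \<partial>lborel) = ennreal (m powr - real DIM('a)) * I" if "0 < m" for m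
  proof -
    have "(\<integral>\<^sup>+x. ennreal (\<bar>bump m (x::'a)\<bar> powr q) \<partial>lborel) = (\<integral>\<^sup>+x. ennreal (\<bar>bump 1 (m *\<^sub>R x :: 'a)\<bar> powr q) \<partial>lborel)"
      by (simp add: bump_scale[of m])
    also have "\<dots> = ennreal (m powr - real DIM('a)) * I"
      unfolding I_def by (rule nn_integral_lborel_scale[OF _ that, of "\<lambda>x. ennreal (\<bar>bump 1 x\<bar> powr q)"]) measurable
    finally show ?thesis .
  qed
  have "I \<le> (\<integral>\<^sup>+x. indicator (ball (0::'a) 1) x \<partial>lborel)"
    unfolding I_def
  proof (rule nn_integral_mono)
    fix x :: 'a
    show "ennreal (\<bar>bump 1 x\<bar> powr q) \<le> indicator (ball (0::'a) 1) x"
      using assms bump_eq_0[of 1 x] bump_le_1[of 1 x] bump_nonneg[of 1 x]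
      by (auto simp: indicator_def powr_le1)
  qed
  also have "\<dots> < \<infinity>" using emeasure_lborel_ball_finite by simp
  finally have "I < \<infinity>" .
  moreover have "I \<noteq> 0"
  proof
    assume "I = 0"
    then have "AE x in lebesgue. bump 1 (x::'a) = 0" unfolding I_def
      by (subst (asm) nn_integral_0_iff_AE) (auto simp: AE_completion_iff)
    then have "\<exists>x\<in>ball 0 1. bump 1 (x::'a) = 0" by (rule AE_lebesgue_open_ex) auto
    then show False using bump_pos[of 1] by force
  qed
  ultimately obtain B where "I = ennreal B" "0 < B"
    by (cases I) (auto simp: zero_less_iff_neq_zero)
  then show ?thesis using that[of B] m by (simp add: ennreal_mult mult.commute)
qed

lemma ennreal_powr_le:
  assumes "1 \<le> p" "0 \<le> A" "X \<le> ennreal A"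
  shows "ennreal_powr X (1 / p) \<le> ennreal (A powr (1 / p))"
  using ennreal_powr_mono[OF assms(3), of "1 / p"] assms by (simp add: ennreal_powr_ennreal)

text \<open>In both cases the seminorm is estimated by the L^p norm of a function \<open>F\<close>
  that tends to 0 almost everywhere along \<open>m = 2 ^ k\<close> with bounded norms. By the
  triangle inequality the seminorm of an average of bumps is at most the norm of the average of the
  \<open>F\<close>, and \<open>Banach_Saks_averages\<close> applies.\<close>

lemma bump_critical_seminorm:
  assumes s: "0 < s" "s \<le> 1" "1 < p" and sp: "s * p = real DIM('a::euclidean_space)"
  obtains A where "0 \<le> A" "\<And>m. 0 < m \<Longrightarrow> sobolev_seminorm UNIV s p (bump m :: 'a \<Rightarrow> real) \<le> ennreal (A powr (1 / p))"
    "\<And>k0 e. 0 < e \<Longrightarrow> \<exists>K. finite K \<and> K \<noteq> {} \<and> K \<subseteq> {k0..} \<and>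
      sobolev_seminorm UNIV s p (\<lambda>x::'a. \<Sum>k\<in>K. bump (2 ^ k) x / card K) \<le> ennreal (e powr (1 / p))"
proof (cases "s = 1")
  case True
  define F where "F m x = norm (bump_grad m (x::'a))" for m x
  have [measurable]: "F m \<in> borel_measurable borel" for m unfolding F_def by measurable
  \<comment> \<open>For \<open>s = 1\<close> the dimension is \<open>p\<close>, so the gradient
    bound \<open>(4 * m) powr p\<close> and the volume factor \<open>m powr - p\<close> of the
    support cancel.\<close>
  define A where "A = (4 powr p) * measure lborel (ball (0::'a) 1)"
  have A0: "0 \<le> A" by (simp add: A_def)
  have FA: "(\<integral>\<^sup>+x. ennreal (F m x powr p) \<partial>lborel) \<le> ennreal A" if m: "0 < m" for m
  proof -
    have "(\<integral>\<^sup>+x. ennreal (F m x powr p) \<partial>lborel) \<le> (\<integral>\<^sup>+x. ennreal ((4 * m) powr p) * indicator (ball (0::'a) (1 / m)) x \<partial>lborel)"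
    proof (rule nn_integral_mono)
      fix x
      show "ennreal (F m x powr p) \<le> ennreal ((4 * m) powr p) * indicator (ball (0::'a) (1 / m)) x"
        using m s bump_grad_eq_0[of m x] bump_grad_le[of m x]
        by (auto simp: indicator_def F_def intro!: ennreal_leI powr_mono2)
    qed
    also have "\<dots> = ennreal ((4 * m) powr p) * emeasure lborel (ball (0::'a) (1 / m))"
      by (rule nn_integral_cmult_indicator) simp
    also have "\<dots> = ennreal ((4 * m) powr p * (m powr - p * measure lborel (ball (0::'a) 1)))"
      using sp True by (simp add: emeasure_lborel_ball_scale[OF m] ennreal_mult)
    also have "(4 * m) powr p * (m powr - p * measure lborel (ball (0::'a) 1)) = A"
      using m by (simp add: A_def powr_mult powr_minus)
    finally show ?thesis by simp
  qed
  show ?thesis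
  proof (rule that[OF A0])
    fix m :: real assume m: "0 < m"
    have "sobolev_seminorm UNIV 1 p (bump m :: 'a \<Rightarrow> real) \<le> ennreal_powr (\<integral>\<^sup>+x. ennreal (F m x powr p) \<partial>lborel) (1 / p)"
      unfolding F_def by (rule sobolev_seminorm_1_le[OF bump_has_derivative continuous_bump_grad])
    also have "\<dots> \<le> ennreal (A powr (1 / p))"
      using s by (intro ennreal_powr_le FA m A0) auto
    finally show "sobolev_seminorm UNIV s p (bump m :: 'a \<Rightarrow> real) \<le> ennreal (A powr (1 / p))" using True by simp
  next
    fix k0 and e :: real assume e: "0 < e"
    obtain K where K: "finite K" "K \<noteq> {}" "K \<subseteq> {k0..}"
      "(\<integral>\<^sup>+x. ennreal ((\<Sum>k\<in>K. F (2 ^ k) x / card K) powr p) \<partial>lborel) \<le> ennreal e"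
    proof (rule Banach_Saks_averages[of p "\<lambda>k. F (2 ^ k)" lborel A e k0])
      show "AE x in lborel. (\<lambda>k. F (2 ^ k) x) \<longlonglongrightarrow> 0"
      proof (rule AE_I2)
        fix x :: 'a
        show "(\<lambda>k. F (2 ^ k) x) \<longlonglongrightarrow> 0"
        proof (cases "x = 0")
          case False
          then obtain k1 where k1: "1 / norm x < 2 ^ k1" using real_arch_pow[of 2] by auto
          \<comment> \<open>Any fixed point other than the origin eventually leaves the shrinking
            supports; at the origin the gradient is 0 anyway.\<close>
          have "F (2 ^ k) x = 0" if "k1 \<le> k" for k
          proof -
            have "1 / norm x \<le> 2 ^ k" using k1 that power_increasing[of k1 k "2::real"] by linarith
            then show ?thesis using False by (simp add: F_def bump_grad_eq_0 field_simps)
          qed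
          then show ?thesis by (intro tendsto_eventually) (auto simp: eventually_sequentially)
        qed (simp add: F_def bump_grad_def)
      qed
    qed (use s e FA A0 in \<open>auto simp: F_def\<close>)
    let ?G = "\<lambda>x::'a. \<Sum>k\<in>K. bump_grad (2 ^ k) x /\<^sub>R card K"
    have "sobolev_seminorm UNIV 1 p (\<lambda>x::'a. \<Sum>k\<in>K. bump (2 ^ k) x / card K) \<le>
        ennreal_powr (\<integral>\<^sup>+x. ennreal (norm (?G x) powr p) \<partial>lborel) (1 / p)"
    proof (rule sobolev_seminorm_1_le)
      show "((\<lambda>x::'a. \<Sum>k\<in>K. bump (2 ^ k) x / card K) has_derivative (\<lambda>h. ?G x \<bullet> h)) (at x)" for x
        unfolding inner_sum_left inner_scaleR_left divide_inverse
        by (intro has_derivative_sum)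
          (simp add: mult.commute has_derivative_mult_right[OF bump_has_derivative])
      show "continuous_on UNIV ?G" by (intro continuous_intros continuous_bump_grad)
    qed
    also have "\<dots> \<le> ennreal (e powr (1 / p))"
    proof (rule ennreal_powr_le)
      have "norm (?G x) \<le> (\<Sum>k\<in>K. F (2 ^ k) x / card K)" for x
        by (rule order_trans[OF norm_sum]) (simp add: F_def divide_inverse mult.commute)
      then have "(\<integral>\<^sup>+x. ennreal (norm (?G x) powr p) \<partial>lborel) \<le> (\<integral>\<^sup>+x. ennreal ((\<Sum>k\<in>K. F (2 ^ k) x / card K) powr p) \<partial>lborel)"
        using s by (intro nn_integral_mono ennreal_leI powr_mono2) auto
      then show "(\<integral>\<^sup>+x. ennreal (norm (?G x) powr p) \<partial>lborel) \<le> ennreal e" using K(4) by (rule order_trans)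
    qed (use s e in auto)
    finally show "\<exists>K. finite K \<and> K \<noteq> {} \<and> K \<subseteq> {k0..} \<and>
      sobolev_seminorm UNIV s p (\<lambda>x::'a. \<Sum>k\<in>K. bump (2 ^ k) x / card K) \<le> ennreal (e powr (1 / p))"
      using True K by blast
  qed
next
  case False
  then have s1: "s < 1" using s by simp
  define c where "c = c_const DIM('a) s p"
  have c: "0 < c" unfolding c_def by (rule c_const_pos) (use s s1 in \<open>auto simp: Suc_le_eq\<close>)
  \<comment> \<open>With the normalizing constant inside the density, the seminorm is exactly an L^p
    norm of differences over \<open>M\<close>.\<close>
  define w where "w z = ennreal (c / norm (fst z - snd z) powr (real DIM('a) + s * p))" for z :: "'a \<times> 'a"
  define M where "M = density lborel w"
  define F where "F m z = \<bar>bump m (fst z) - bump m (snd z)\<bar>" for m and z :: "'a \<times> 'a"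
  have [measurable]: "fst \<in> borel_measurable (borel :: ('a \<times> 'a) measure)"
    "snd \<in> borel_measurable (borel :: ('a \<times> 'a) measure)"
    by (auto intro!: borel_measurable_continuous_onI continuous_intros)
  have [measurable]: "w \<in> borel_measurable borel" unfolding w_def by measurable
  have [measurable]: "F m \<in> borel_measurable borel" for m unfolding F_def by measurable
  have [measurable]: "F m \<in> borel_measurable M" for m unfolding M_def by measurable
  have semi: "sobolev_seminorm UNIV s p u =
      ennreal_powr (\<integral>\<^sup>+z. ennreal (\<bar>u (fst z) - u (snd z)\<bar> powr p) \<partial>M) (1 / p)"
    if u[measurable]: "u \<in> borel_measurable borel" for u :: "'a \<Rightarrow> real"
  proof -
    have "(\<integral>\<^sup>+z. ennreal (\<bar>u (fst z) - u (snd z)\<bar> powr p) \<partial>M) =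
       (\<integral>\<^sup>+z. w z * ennreal (\<bar>u (fst z) - u (snd z)\<bar> powr p) \<partial>lborel)"
      unfolding M_def by (subst nn_integral_density) auto
    also have "\<dots> = (\<integral>\<^sup>+z. ennreal c * ennreal (\<bar>u (fst z) - u (snd z)\<bar> powr p / norm (fst z - snd z) powr (real DIM('a) + s * p)) \<partial>lborel)"
      using c by (intro nn_integral_cong) (simp add: w_def flip: ennreal_mult)
    also have "\<dots> = ennreal c * gagliardo_integral s p u"
      by (simp add: nn_integral_cmult nn_integral_lborel_pair gagliardo_integral_def)
    finally show ?thesis using s s1 by (simp add: sobolev_seminorm_def gagliardo_eq[OF u] c_def)
  qed
  have "ennreal c * gagliardo_integral s p (bump 1 :: 'a \<Rightarrow> real) < \<infinity>"
    using gagliardo_integral_bump_finite[of s p, where 'a='a] s s1 by (simp add: ennreal_mult_less_top)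
  then obtain A where A: "0 \<le> A" "ennreal c * gagliardo_integral s p (bump 1 :: 'a \<Rightarrow> real) = ennreal A"
    by (cases "ennreal c * gagliardo_integral s p (bump 1 :: 'a \<Rightarrow> real)") auto
  have FA: "(\<integral>\<^sup>+z. ennreal (F m z powr p) \<partial>M) \<le> ennreal A" if m: "0 < m" for m
  proof -
    have "ennreal_powr (\<integral>\<^sup>+z. ennreal (F m z powr p) \<partial>M) (1 / p) = ennreal_powr (ennreal A) (1 / p)"
      using semi[of "bump m"] s s1 sp m A(2) unfolding F_def
      by (simp add: sobolev_seminorm_def gagliardo_eq gagliardo_integral_bump_scale[OF m] c_def)
    then have "ennreal_powr (ennreal_powr (\<integral>\<^sup>+z. ennreal (F m z powr p) \<partial>M) (1 / p)) p
        = ennreal_powr (ennreal_powr (ennreal A) (1 / p)) p" by simp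
    then show ?thesis using s by (simp add: ennreal_powr_inverse)
  qed
  show ?thesis
  proof (rule that[OF A(1)])
    fix m :: real assume m: "0 < m"
    show "sobolev_seminorm UNIV s p (bump m :: 'a \<Rightarrow> real) \<le> ennreal (A powr (1 / p))"
      using ennreal_powr_le[OF _ A(1) FA[OF m], of p] s by (simp add: semi F_def)
  next
    fix k0 and e :: real assume e: "0 < e"
    obtain K where K: "finite K" "K \<noteq> {}" "K \<subseteq> {k0..}"
      "(\<integral>\<^sup>+x. ennreal ((\<Sum>k\<in>K. F (2 ^ k) x / card K) powr p) \<partial>M) \<le> ennreal e"
    proof (rule Banach_Saks_averages[of p "\<lambda>k. F (2 ^ k)" M A e k0])
      have b0: "(\<lambda>k. bump (2 ^ k) x) \<longlonglongrightarrow> 0" if "x \<noteq> 0" for x :: 'a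
      proof -
        obtain k1 where k1: "1 / norm x < 2 ^ k1" using real_arch_pow[of 2] by auto
        have "bump (2 ^ k) x = 0" if "k1 \<le> k" for k
        proof -
          have "1 / norm x \<le> 2 ^ k" using k1 that power_increasing[of k1 k "2::real"] by linarith
          then show ?thesis using \<open>x \<noteq> 0\<close> by (simp add: bump_eq_0 field_simps)
        qed
        then show ?thesis by (intro tendsto_eventually) (auto simp: eventually_sequentially)
      qed
      have F0: "(\<lambda>k. F (2 ^ k) z) \<longlonglongrightarrow> 0" if "fst z \<noteq> 0" "snd z \<noteq> 0" for z
        using tendsto_rabs[OF tendsto_diff[OF b0[OF that(1)] b0[OF that(2)]]] by (simp add: F_def)
      \<comment> \<open>At the origin every bump equals \<open>exp (- 1)\<close>, so pairs with a
        zero component have to be discarded; they form a null set.\<close>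
      have "emeasure (lborel \<Otimes>\<^sub>M lborel) ({0::'a} \<times> (UNIV :: 'a set)) = 0"
        "emeasure (lborel \<Otimes>\<^sub>M lborel) ((UNIV :: 'a set) \<times> {0::'a}) = 0"
        by (subst lborel.emeasure_pair_measure_Times; simp)+
      then have "{0::'a} \<times> (UNIV :: 'a set) \<in> null_sets (lborel \<Otimes>\<^sub>M lborel)"
        "(UNIV :: 'a set) \<times> {0::'a} \<in> null_sets (lborel \<Otimes>\<^sub>M lborel)"
        by (auto simp: null_sets_def simp del: lborel_prod)
      then have "{0::'a} \<times> (UNIV :: 'a set) \<union> (UNIV :: 'a set) \<times> {0::'a} \<in> null_sets lborel"
        unfolding lborel_prod by (rule null_sets.Un)
      then have "AE z in lborel. (\<lambda>k. F (2 ^ k) z) \<longlonglongrightarrow> 0"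
        by (rule AE_I') (use F0 in \<open>fastforce simp: mem_Times_iff\<close>)
      then show "AE z in M. (\<lambda>k. F (2 ^ k) z) \<longlonglongrightarrow> 0"
        unfolding M_def by (subst AE_density) auto
    qed (use s e FA A in \<open>auto simp: F_def\<close>)
    have "sobolev_seminorm UNIV s p (\<lambda>x::'a. \<Sum>k\<in>K. bump (2 ^ k) x / card K) \<le> ennreal (e powr (1 / p))"
    proof (subst semi)
      show "ennreal_powr (\<integral>\<^sup>+z. ennreal (\<bar>(\<Sum>k\<in>K. bump (2 ^ k) (fst z) / real (card K)) -
          (\<Sum>k\<in>K. bump (2 ^ k) (snd z) / real (card K))\<bar> powr p) \<partial>M) (1 / p) \<le> ennreal (e powr (1 / p))"
      proof (rule ennreal_powr_le)
        have "\<bar>(\<Sum>k\<in>K. bump (2 ^ k) (fst z) / real (card K)) - (\<Sum>k\<in>K. bump (2 ^ k) (snd z) / real (card K))\<bar>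
          \<le> (\<Sum>k\<in>K. F (2 ^ k) z / card K)" for z
          unfolding sum_subtractf[symmetric]
          by (rule order_trans[OF sum_abs]) (simp add: F_def flip: diff_divide_distrib)
        then show "(\<integral>\<^sup>+z. ennreal (\<bar>(\<Sum>k\<in>K. bump (2 ^ k) (fst z) / real (card K)) -
          (\<Sum>k\<in>K. bump (2 ^ k) (snd z) / real (card K))\<bar> powr p) \<partial>M) \<le> ennreal e"
          using s by (intro order_trans[OF _ K(4)] nn_integral_mono ennreal_leI powr_mono2) auto
      qed (use s e in auto)
    qed measurable
    then show "\<exists>K. finite K \<and> K \<noteq> {} \<and> K \<subseteq> {k0..} \<and>
      sobolev_seminorm UNIV s p (\<lambda>x::'a. \<Sum>k\<in>K. bump (2 ^ k) x / card K) \<le> ennreal (e powr (1 / p))"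
      using K by blast
  qed
qed

section \<open>Target spaces outside the admissible range\<close>

lemma bump_bound:
  assumes emb: "continuously_embedded (UNIV :: 'a::euclidean_space set) s (ereal p) s' p'"
    and s: "0 < s" "s \<le> 1" "1 < p" and sp: "s * p = real DIM('a)"
  obtains C A B where "0 \<le> C" "0 \<le> A" "0 \<le> B" "\<And>m. 0 < m \<Longrightarrow>
    sobolev_norm UNIV s' p' (bump m :: 'a \<Rightarrow> real) \<le> ennreal (C * (A + B * m powr - real DIM('a)) powr (1 / p))"
proof -
  obtain C where C: "0 \<le> C"
    "\<And>(u :: 'a \<Rightarrow> real) a b. \<lbrakk>u \<in> borel_measurable borel; 0 \<le> a; 0 \<le> b;
       sobolev_seminorm UNIV s p u \<le> ennreal (a powr (1 / p));
       (\<integral>\<^sup>+x. ennreal (\<bar>u x\<bar> powr p) \<partial>lborel) \<le> ennreal b\<rbrakk>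
     \<Longrightarrow> sobolev_norm UNIV s' p' u \<le> ennreal (C * (a + b) powr (1 / p))"
    using embedding_bound[OF emb] s by auto
  obtain A where A: "0 \<le> A" "\<And>m. 0 < m \<Longrightarrow> sobolev_seminorm UNIV s p (bump m :: 'a \<Rightarrow> real) \<le> ennreal (A powr (1 / p))"
    using bump_critical_seminorm[OF s sp] by metis
  obtain B where B: "0 < B" "\<And>m. 0 < m \<Longrightarrow>
    (\<integral>\<^sup>+x. ennreal (\<bar>bump m (x::'a)\<bar> powr p) \<partial>lborel) = ennreal (B * m powr - real DIM('a))"
    using nn_integral_bump_powr[of p, where 'a='a] s by auto
  have "sobolev_norm UNIV s' p' (bump m :: 'a \<Rightarrow> real) \<le> ennreal (C * (A + B * m powr - real DIM('a)) powr (1 / p))"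
    if "0 < m" for m
    by (rule C(2)) (use that A B in auto)
  with C(1) A(1) B(1) show ?thesis by (intro that[of C A B]) auto
qed

lemma bump_bound_concentrating:
  assumes emb: "continuously_embedded (UNIV :: 'a::euclidean_space set) s (ereal p) s' p'"
    and s: "0 < s" "s \<le> 1" "1 < p" and sp: "s * p = real DIM('a)"
  obtains K where "0 \<le> K" "\<And>m. 1 \<le> m \<Longrightarrow> sobolev_norm UNIV s' p' (bump m :: 'a \<Rightarrow> real) \<le> ennreal K"
proof -
  obtain C A B where C: "0 \<le> C" "0 \<le> A" "0 \<le> B" "\<And>m. 0 < m \<Longrightarrow>
    sobolev_norm UNIV s' p' (bump m :: 'a \<Rightarrow> real) \<le> ennreal (C * (A + B * m powr - real DIM('a)) powr (1 / p))"
    using bump_bound[OF assms] by metis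
  have "sobolev_norm UNIV s' p' (bump m :: 'a \<Rightarrow> real) \<le> ennreal (C * (A + B) powr (1 / p))" if m: "1 \<le> m" for m
  proof -
    have "m powr - real DIM('a) \<le> m powr 0" using m by (intro powr_mono) auto
    then have "B * m powr - real DIM('a) \<le> B * 1" using m C(3) by (intro mult_left_mono) auto
    then have "C * (A + B * m powr - real DIM('a)) powr (1 / p) \<le> C * (A + B) powr (1 / p)"
      using C s by (intro mult_left_mono powr_mono2) auto
    then show ?thesis using C(4)[of m] m by (meson ennreal_leI order_trans less_le_trans zero_less_one)
  qed
  then show ?thesis using that[of "C * (A + B) powr (1 / p)"] C by simp
qed

text \<open>Spreading out, with \<open>m = 1 / x\<close>: the L^q part of the target norm grows like
  \<open>x powr (N / q)\<close>, the source norm at most like \<open>x powr (N / p)\<close>.\<close>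

lemma not_embedded_smaller_exponent:
  assumes s: "0 < s" "s \<le> 1" "1 < p" and sp: "s * p = real DIM('a::euclidean_space)"
    and q: "1 \<le> q" "q < p"
  shows "\<not> continuously_embedded (UNIV :: 'a set) s (ereal p) s' (ereal q)"
proof
  assume emb: "continuously_embedded (UNIV :: 'a set) s (ereal p) s' (ereal q)"
  define N where "N = real DIM('a)"
  have N: "0 < N" by (simp add: N_def)
  obtain C A B where C: "0 \<le> C" "0 \<le> A" "0 \<le> B" "\<And>m. 0 < m \<Longrightarrow>
    sobolev_norm UNIV s' (ereal q) (bump m :: 'a \<Rightarrow> real) \<le> ennreal (C * (A + B * m powr - N) powr (1 / p))"
    unfolding N_def using bump_bound[OF emb s sp] by metis
  obtain D where D: "0 < D" "\<And>m. 0 < m \<Longrightarrow>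
    (\<integral>\<^sup>+x. ennreal (\<bar>bump m (x::'a)\<bar> powr q) \<partial>lborel) = ennreal (D * m powr - N)"
    unfolding N_def using nn_integral_bump_powr[of q, where 'a='a] q by auto
  define K where "K = (C * (A + B) powr (1 / p)) powr q"
  have "x powr (N - N * q / p) \<le> K / D" if x: "1 \<le> x" for x
  proof -
    have [simp]: "(1 / x) powr - N = x powr N" using x by (simp add: powr_minus powr_divide)
    have x1: "1 \<le> x powr N" using x N by (simp add: ge_one_powr_ge_zero)
    have "ennreal_powr (ennreal (D * x powr N)) (1 / q) \<le> sobolev_norm UNIV s' (ereal q) (bump (1 / x) :: 'a \<Rightarrow> real)"
      using Lp_norm_le_sobolev_norm[OF q(1), of UNIV "bump (1 / x) :: 'a \<Rightarrow> real" s'] D(2)[of "1 / x"] x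
      by (simp add: Lp_norm_eq)
    also have "\<dots> \<le> ennreal (C * (A + B * x powr N) powr (1 / p))"
      using C(4)[of "1 / x"] x by simp
    finally have "ennreal (D * x powr N) \<le> ennreal ((C * (A + B * x powr N) powr (1 / p)) powr q)"
      using q C by (intro ennreal_powr_le_imp_le) auto
    then have "D * x powr N \<le> (C * (A + B * x powr N) powr (1 / p)) powr q" by simp
    also have "\<dots> \<le> (C * ((A + B) * x powr N) powr (1 / p)) powr q"
      using C x1 s q mult_left_mono[OF x1 C(2)]
      by (intro powr_mono2 mult_left_mono mult_nonneg_nonneg) (auto simp: algebra_simps)
    also have "\<dots> = K * x powr (N * q / p)"
      using C x by (simp add: K_def powr_mult powr_powr)
    finally have "D * x powr N \<le> K * x powr (N * q / p)" .
    then show ?thesis using D(1) x by (simp add: powr_diff field_simps)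
  qed
  moreover have "N * q < N * p" using N q by simp
  then have "0 < N - N * q / p" using s by (simp add: pos_divide_less_eq)
  ultimately show False using powr_not_bounded by blast
qed

lemma not_embedded_fractional:
  assumes s: "0 < s" "s \<le> 1" "1 < p" and sp: "s * p = real DIM('a::euclidean_space)"
    and q: "1 \<le> q" and s': "0 < s'" "s' < 1" and sq: "real DIM('a) < s' * q"
  shows "\<not> continuously_embedded (UNIV :: 'a set) s (ereal p) s' (ereal q)"
proof
  assume emb: "continuously_embedded (UNIV :: 'a set) s (ereal p) s' (ereal q)"
  obtain K where K: "0 \<le> K" "\<And>m. 1 \<le> m \<Longrightarrow> sobolev_norm UNIV s' (ereal q) (bump m :: 'a \<Rightarrow> real) \<le> ennreal K"
    using bump_bound_concentrating[OF emb s sp] by metis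
  define c where "c = c_const DIM('a) s' q"
  have c: "0 < c" unfolding c_def by (rule c_const_pos) (use s' q in \<open>auto simp: Suc_le_eq\<close>)
  define J where "J = gagliardo_integral s' q (bump 1 :: 'a \<Rightarrow> real)"
  have bd: "ennreal c * (ennreal (m powr (s' * q - real DIM('a))) * J) \<le> ennreal (K powr q)" if m: "1 \<le> m" for m
  proof (rule ennreal_powr_le_imp_le)
    have "sobolev_seminorm UNIV s' q (bump m :: 'a \<Rightarrow> real) \<le> ennreal K"
      using order_trans[OF sobolev_seminorm_le_sobolev_norm[OF q] K(2)[OF m]] s' by simp
    then have "gagliardo UNIV s' q (bump m :: 'a \<Rightarrow> real) \<le> ennreal K"
      using s' by (simp add: sobolev_seminorm_def)
    moreover have m0: "0 < m" using m by simp
    ultimately show "ennreal_powr (ennreal c * (ennreal (m powr (s' * q - real DIM('a))) * J)) (1 / q) \<le> ennreal K"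
      by (simp only: gagliardo_eq[OF bump_measurable] gagliardo_integral_bump_scale[OF m0] J_def c_def)
  qed (use q K in auto)
  \<comment> \<open>The assumed embedding, applied at \<open>m = 1\<close>, already shows that
    \<open>J\<close> is finite.\<close>
  have "ennreal c * J \<le> ennreal (K powr q)"
    using bd[OF order_refl] unfolding powr_one_eq_one ennreal_1 mult_1_left .
  then have "ennreal c * J < \<infinity>" by (rule le_less_trans) simp
  then have "J < \<infinity>" using c by (auto simp: ennreal_mult_less_top)
  moreover have "0 < J" unfolding J_def by (rule gagliardo_integral_bump_pos)
  ultimately obtain j where j: "J = ennreal j" "0 < j" by (cases J) auto
  have "m powr (s' * q - real DIM('a)) \<le> K powr q / (c * j)" if m: "1 \<le> m" for m
    using bd[OF m] c j by (simp add: field_simps flip: ennreal_mult)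
  moreover have "0 < s' * q - real DIM('a)" using sq by simp
  ultimately show False using powr_not_bounded by blast
qed

text \<open>Any Hoelder representative agrees with the bump at some point near the origin, where it
  is at least \<open>c\<close>, and at some point of a ring outside the support, where it is 0.
  These points are at most \<open>3 / m\<close> apart, so the Hoelder quotient is at least of order
  \<open>m powr s'\<close>.\<close>

lemma not_embedded_Hoelder:
  assumes s: "0 < s" "s \<le> 1" "1 < p" and sp: "s * p = real DIM('a::euclidean_space)"
    and s': "0 < s'"
  shows "\<not> continuously_embedded (UNIV :: 'a set) s (ereal p) s' \<infinity>"
proof
  assume emb: "continuously_embedded (UNIV :: 'a set) s (ereal p) s' \<infinity>"
  obtain K where K: "0 \<le> K" "\<And>m. 1 \<le> m \<Longrightarrow> sobolev_norm UNIV s' \<infinity> (bump m :: 'a \<Rightarrow> real) \<le> ennreal K"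
    using bump_bound_concentrating[OF emb s sp] by metis
  define c :: real where "c = exp (- 4 / 3)"
  have c: "0 < c" by (simp add: c_def)
  have "m powr s' \<le> (K + 1) * 3 powr s' / c" if m: "1 \<le> m" for m
  proof -
    \<comment> \<open>The strict bound with \<open>K + 1\<close> makes the infimum yield an actual
      representative.\<close>
    have "(INF v\<in>holder_representatives UNIV s' (bump m :: 'a \<Rightarrow> real). holder_norm UNIV s' v) < ennreal (K + 1)"
      using K(2)[OF m] K(1) s' by (auto simp: sobolev_norm_def intro: le_less_trans ennreal_lessI)
    then obtain v where v: "v \<in> holder_representatives UNIV s' (bump m :: 'a \<Rightarrow> real)"
      "holder_norm UNIV s' v < ennreal (K + 1)"
      by (auto simp: INF_less_iff)
    have AE: "AE x in lebesgue. bump m x = v x"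
      using v(1) unfolding holder_representatives_def lebesgue_on_UNIV_eq by simp
    obtain x where x: "x \<in> ball 0 (1 / (2 * m))" "bump m x = v x"
      using AE_lebesgue_open_ex[OF AE, of "ball 0 (1 / (2 * m))"] m by auto
    obtain b :: 'a where b: "b \<in> Basis" using nonempty_Basis by blast
    have "(3 / (2 * m)) *\<^sub>R b \<in> ball 0 (2 / m) - cball 0 (1 / m)"
      using b m by (simp add: field_simps)
    then obtain y where y: "y \<in> ball 0 (2 / m) - cball 0 (1 / m)" "bump m y = v y"
      using AE_lebesgue_open_ex[OF AE, of "ball 0 (2 / m) - cball 0 (1 / m)"] by (metis empty_iff open_Diff open_ball closed_cball)
    have "x \<noteq> y" using x y m by (auto simp: field_simps)
    have vy: "v y = 0" using y bump_eq_0[of m y] m by simp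
    have vx: "c \<le> v x" using x bump_ge[of m x] m by (simp add: c_def)
    have "ennreal (\<bar>v x - v y\<bar> / norm (x - y) powr s') \<le>
      (SUP (x, y)\<in>{(x, y). x \<in> UNIV \<and> y \<in> UNIV \<and> x \<noteq> y}. ennreal (\<bar>v x - v y\<bar> / norm (x - y) powr s'))"
      using \<open>x \<noteq> y\<close> by (intro SUP_upper2[of "(x, y)"]) auto
    also have "\<dots> \<le> holder_norm UNIV s' v" by (simp add: holder_norm_def)
    finally have "ennreal (\<bar>v x - v y\<bar> / norm (x - y) powr s') < ennreal (K + 1)"
      using v(2) by (rule le_less_trans)
    then have "\<bar>v x - v y\<bar> / norm (x - y) powr s' \<le> K + 1"
      by (metis ennreal_less_iff divide_nonneg_nonneg abs_ge_zero powr_ge_zero less_imp_le)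
    then have "v x \<le> (K + 1) * norm (x - y) powr s'"
      using \<open>x \<noteq> y\<close> vy by (simp add: field_simps)
    also have "\<dots> \<le> (K + 1) * (3 / m) powr s'"
    proof -
      have "norm (x - y) \<le> norm x + norm y" by (rule norm_triangle_ineq4)
      also have "\<dots> \<le> 1 / (2 * m) + 2 / m" using x y by simp
      also have "\<dots> \<le> 3 / m" using m by (simp add: field_simps)
      finally show ?thesis using K(1) s' by (intro mult_left_mono powr_mono2) auto
    qed
    finally have "c \<le> (K + 1) * (3 / m) powr s'" using vx by simp
    then show ?thesis using m c by (simp add: powr_divide field_simps)
  qed
  then show False using powr_not_bounded[OF s'] by blast
qed

lemma not_embedded_Linfinity:
  assumes s: "0 < s" "s \<le> 1" "1 < p" and sp: "s * p = real DIM('a::euclidean_space)"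
  shows "\<not> continuously_embedded (UNIV :: 'a set) s (ereal p) 0 \<infinity>"
proof
  assume emb: "continuously_embedded (UNIV :: 'a set) s (ereal p) 0 \<infinity>"
  obtain C where C: "0 \<le> C"
    "\<And>(u :: 'a \<Rightarrow> real) a b. \<lbrakk>u \<in> borel_measurable borel; 0 \<le> a; 0 \<le> b;
       sobolev_seminorm UNIV s p u \<le> ennreal (a powr (1 / p));
       (\<integral>\<^sup>+x. ennreal (\<bar>u x\<bar> powr p) \<partial>lborel) \<le> ennreal b\<rbrakk>
     \<Longrightarrow> sobolev_norm UNIV 0 \<infinity> u \<le> ennreal (C * (a + b) powr (1 / p))"
    using embedding_bound[OF emb] s by auto
  obtain A where A: "\<And>k0 e. 0 < e \<Longrightarrow> \<exists>K. finite K \<and> K \<noteq> {} \<and> K \<subseteq> {k0::nat..} \<and>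
      sobolev_seminorm UNIV s p (\<lambda>x::'a. \<Sum>k\<in>K. bump (2 ^ k) x / card K) \<le> ennreal (e powr (1 / p))"
    using bump_critical_seminorm[OF s sp] by metis
  define c :: real where "c = exp (- 4 / 3)"
  have c: "0 < c" by (simp add: c_def)
  define V where "V = measure lborel (ball (0::'a) 1)"
  have V: "0 \<le> V" by (simp add: V_def)
  \<comment> \<open>Chosen so that \<open>C * (e + e) powr (1 / p)\<close> equals
    \<open>C * c / (2 * (C + 1))\<close>, which is below \<open>c\<close>; one \<open>e\<close> is
    for the seminorm, one for the L^p part.\<close>
  define e where "e = (c / (2 * (C + 1))) powr p / 2"
  have e: "0 < e" using c C(1) by (simp add: e_def)
  \<comment> \<open>All supports are to lie in the ball of radius \<open>1 / 2 ^ k0\<close>, whose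
    volume, by \<open>N \<ge> 1\<close>, is then at most \<open>e\<close>.\<close>
  obtain k0 :: nat where k0: "V / e < 2 ^ k0" using real_arch_pow[of 2] by auto
  obtain K where K: "finite K" "K \<noteq> {}" "K \<subseteq> {k0..}"
    "sobolev_seminorm UNIV s p (\<lambda>x::'a. \<Sum>k\<in>K. bump (2 ^ k) x / card K) \<le> ennreal (e powr (1 / p))"
    using A[OF e] by blast
  define u where "u x = (\<Sum>k\<in>K. bump (2 ^ k) x / card K)" for x :: 'a
  have [measurable]: "u \<in> borel_measurable borel" unfolding u_def by measurable
  have cardK: "0 < real (card K)" using K by (simp add: card_gt_0_iff)
  have u0: "0 \<le> u x" for x unfolding u_def by (intro sum_nonneg divide_nonneg_nonneg bump_nonneg) simp
  have u1: "u x \<le> 1" for x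
  proof -
    have "u x \<le> (\<Sum>k\<in>K. 1 / card K)"
      unfolding u_def by (intro sum_mono divide_right_mono bump_le_1) simp
    then show ?thesis using cardK by simp
  qed
  have usupp: "u x = 0" if "1 / 2 ^ k0 \<le> norm x" for x
  proof -
    have "bump (2 ^ k) x = 0" if "k \<in> K" for k
    proof (rule bump_eq_0)
      have "(2::real) ^ k0 \<le> 2 ^ k" using that K(3) by (intro power_increasing) auto
      then have "1 / (2::real) ^ k \<le> 1 / 2 ^ k0" by (simp add: field_simps)
      then show "1 / 2 ^ k \<le> norm x" using \<open>1 / 2 ^ k0 \<le> norm x\<close> by simp
    qed simp
    then show ?thesis by (simp add: u_def)
  qed
  have "(\<integral>\<^sup>+x. ennreal (\<bar>u x\<bar> powr p) \<partial>lborel) \<le> (\<integral>\<^sup>+x. indicator (ball (0::'a) (1 / 2 ^ k0)) x \<partial>lborel)"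
  proof (rule nn_integral_mono)
    fix x
    show "ennreal (\<bar>u x\<bar> powr p) \<le> indicator (ball 0 (1 / 2 ^ k0)) x"
      using s u0[of x] u1[of x] usupp[of x] by (auto simp: indicator_def powr_le1)
  qed
  also have "\<dots> = ennreal ((2 ^ k0) powr - real DIM('a) * V)"
    by (simp add: emeasure_lborel_ball_scale V_def)
  also have "\<dots> \<le> ennreal e"
  proof (rule ennreal_leI)
    have "((2::real) ^ k0) powr - real DIM('a) \<le> (2 ^ k0) powr - 1" by (intro powr_mono) (auto simp: Suc_le_eq)
    then have "(2 ^ k0) powr - real DIM('a) * V \<le> (2 ^ k0) powr - 1 * V" using V by (rule mult_right_mono)
    also have "\<dots> = V / 2 ^ k0" by (simp add: powr_minus divide_simps)
    also have "\<dots> \<le> e" using k0 e by (simp add: field_simps)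
    finally show "(2 ^ k0) powr - real DIM('a) * V \<le> e" .
  qed
  finally have "sobolev_norm UNIV 0 \<infinity> u \<le> ennreal (C * (e + e) powr (1 / p))"
    using e K(4) unfolding u_def[symmetric] by (intro C(2)) auto
  also have "C * (e + e) powr (1 / p) = C * (c / (2 * (C + 1)))"
    using c C(1) s by (simp add: e_def powr_powr)
  also have "ennreal (C * (c / (2 * (C + 1)))) < ennreal c"
    using c C(1) by (intro ennreal_lessI) (auto simp: field_simps intro: add_nonneg_pos)
  finally have lt: "esssup lebesgue (\<lambda>x. ennreal \<bar>u x\<bar>) < ennreal c"
    by (simp add: sobolev_norm_def Lp_norm_def lebesgue_on_UNIV_eq)
  \<comment> \<open>Half the radius of the smallest support: on this ball all bumps, and hence their
    average, are at least \<open>c\<close>.\<close>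
  define r where "r = 1 / (2 * 2 ^ Max K :: real)"
  have "r > 0" by (simp add: r_def)
  then obtain x where x: "x \<in> ball 0 r" "ennreal \<bar>u x\<bar> \<le> esssup lebesgue (\<lambda>x. ennreal \<bar>u x\<bar>)"
    using AE_lebesgue_open_ex[OF esssup_AE, of "ball 0 r" "\<lambda>x. ennreal \<bar>u x\<bar>"] by auto
  have "c \<le> bump (2 ^ k) x" if "k \<in> K" for k
    unfolding c_def
  proof (rule bump_ge)
    have "(2::real) ^ k \<le> 2 ^ Max K" using that K(1) by (intro power_increasing) auto
    then have "r \<le> 1 / (2 * 2 ^ k)" by (simp add: r_def field_simps)
    then show "norm x \<le> 1 / (2 * 2 ^ k)" using x(1) by simp
  qed simp
  then have "(\<Sum>k\<in>K. c / card K) \<le> u x"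
    unfolding u_def by (intro sum_mono divide_right_mono) auto
  then have "c \<le> u x" using cardK by simp
  then have "ennreal c \<le> ennreal \<bar>u x\<bar>" by (intro ennreal_leI) simp
  with x(2) lt show False by (meson leD order_trans)
qed

text \<open>A substitute for Hoelder's inequality with a free threshold \<open>t\<close>: above
  \<open>t\<close>, a value is at most \<open>t powr (1 - q)\<close> times its q-th power.\<close>

lemma le_add_powr:
  fixes a t q :: real
  assumes "0 \<le> a" "0 < t" "1 \<le> q"
  shows "a \<le> t + t powr (1 - q) * a powr q"
proof (cases "a \<le> t")
  case False
  then have "a powr (1 - q) \<le> t powr (1 - q)" using assms by (intro powr_mono2') auto
  then have "a powr (1 - q) * a powr q \<le> t powr (1 - q) * a powr q" by (rule mult_right_mono) simp
  then show ?thesis using False assms by (simp add: powr_add[symmetric])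
qed (simp add: add_increasing2)

text \<open>Testing with \<open>\<psi> m\<close>, a partial derivative of the bump, forces the
  pairing of any weak gradient \<open>g\<close> with \<open>\<psi> m\<close> to equal
  \<open>G m\<close>, which is \<open>m powr (2 - N) * G 1\<close>. The pairing is bounded above
  through the q-th power integral of \<open>g\<close>, which the embedding bounds uniformly in
  \<open>m\<close>. Comparison of both bounds \<open>m powr (q - N)\<close>.\<close>

lemma not_embedded_gradient:
  assumes s: "0 < s" "s \<le> 1" "1 < p" and sp: "s * p = real DIM('a::euclidean_space)"
    and q: "1 \<le> q" "real DIM('a) < q"
  shows "\<not> continuously_embedded (UNIV :: 'a set) s (ereal p) 1 (ereal q)"
proof
  assume emb: "continuously_embedded (UNIV :: 'a set) s (ereal p) 1 (ereal q)"
  obtain C where C: "0 \<le> C" "\<And>m. 1 \<le> m \<Longrightarrow> sobolev_norm UNIV 1 (ereal q) (bump m :: 'a \<Rightarrow> real) \<le> ennreal C"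
    using bump_bound_concentrating[OF emb s sp] by metis
  define N where "N = real DIM('a)"
  define L where "L = (C + 1) powr q"
  \<comment> \<open>The factor \<open>2 powr N\<close> arises from enclosing the closed ball of
    radius \<open>1 / m\<close> in the open ball of radius \<open>2 / m\<close>.\<close>
  define V where "V = 2 powr N * measure lborel (ball (0::'a) 1)"
  have V: "0 \<le> V" by (simp add: V_def)
  obtain i :: 'a where i: "i \<in> Basis" using nonempty_Basis by blast
  define \<psi> where "\<psi> m x = bump_grad m x \<bullet> i" for m x
  have \<psi>_cont: "continuous_on UNIV (\<psi> m)" for m
    unfolding \<psi>_def by (intro continuous_intros continuous_bump_grad)
  have [measurable]: "\<psi> m \<in> borel_measurable borel" for m
    by (intro borel_measurable_continuous_onI \<psi>_cont)
  have \<psi>_0: "\<psi> m x = 0" if "0 < m" "1 / m \<le> norm x" for m x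
    using bump_grad_eq_0[OF that] by (simp add: \<psi>_def)
  have \<psi>_le: "\<bar>\<psi> m x\<bar> \<le> 4 * m" if "0 < m" for m x
    using Cauchy_Schwarz_ineq2[of "bump_grad m x" i] bump_grad_le[OF that, of x] i by (simp add: \<psi>_def)
  have \<psi>_int: "integrable lborel (\<lambda>x. \<psi> m x * \<psi> m x)" if "0 < m" for m
    by (rule integrable_compact_support[where R="1 / m"])
      (auto intro!: continuous_intros \<psi>_cont simp: \<psi>_0[OF that])
  define G where "G m = (\<integral>x. \<psi> m x * \<psi> m x \<partial>lborel)" for m
  have G_eq: "ennreal (G m) = (\<integral>\<^sup>+x. ennreal (\<psi> m x * \<psi> m x) \<partial>lborel)" if "0 < m" for m
    unfolding G_def by (rule nn_integral_eq_integral[symmetric, OF \<psi>_int[OF that]]) simp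
  have G_nonneg: "0 \<le> G m" for m unfolding G_def by simp
  have G_scale: "G m = m powr (2 - N) * G 1" if m: "0 < m" for m
  proof -
    have "ennreal (G m) = (\<integral>\<^sup>+x. ennreal (m\<^sup>2) * ennreal (\<psi> 1 (m *\<^sub>R x) * \<psi> 1 (m *\<^sub>R x)) \<partial>lborel)"
      unfolding G_eq[OF m] \<psi>_def
      by (subst (1 2) bump_grad_scale) (simp add: power2_eq_square mult_ac flip: ennreal_mult)
    also have "\<dots> = ennreal (m\<^sup>2) * (\<integral>\<^sup>+x. ennreal (\<psi> 1 (m *\<^sub>R x) * \<psi> 1 (m *\<^sub>R x)) \<partial>lborel)"
      by (intro nn_integral_cmult) measurable
    also have "(\<integral>\<^sup>+x. ennreal (\<psi> 1 (m *\<^sub>R x) * \<psi> 1 (m *\<^sub>R x)) \<partial>lborel) = ennreal (m powr - N) * ennreal (G 1)"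
      unfolding N_def G_eq[OF zero_less_one]
      by (rule nn_integral_lborel_scale[OF _ m, of "\<lambda>x. ennreal (\<psi> 1 x * \<psi> 1 x)"]) measurable
    finally have "ennreal (G m) = ennreal (m\<^sup>2 * (m powr - N * G 1))"
      using G_nonneg by (simp add: ennreal_mult)
    then have "G m = m\<^sup>2 * (m powr - N * G 1)" using G_nonneg by simp
    also have "m\<^sup>2 = m powr 2" using m by simp
    finally show ?thesis using m by (simp add: powr_diff powr_minus divide_simps)
  qed
  have G_pos: "0 < G 1"
  proof (rule ccontr)
    assume "\<not> 0 < G 1"
    then have "ennreal (G 1) = 0" by (simp add: ennreal_neg)
    then have "AE x in lebesgue. \<psi> 1 x * \<psi> 1 x = 0"
      unfolding G_eq[OF zero_less_one] by (subst (asm) nn_integral_0_iff_AE) (auto simp: AE_completion_iff ennreal_eq_0_iff mult_le_0_iff)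
    \<comment> \<open>On this half ball the factor \<open>x \<bullet> i\<close> of the partial
      derivative does not vanish.\<close>
    moreover have "open (ball (0::'a) 1 \<inter> {x. 0 < x \<bullet> i})" by (intro open_Int open_ball open_halfspace_component_gt)
    moreover have "(1 / 2) *\<^sub>R i \<in> ball (0::'a) 1 \<inter> {x. 0 < x \<bullet> i}" using i by simp
    ultimately have "\<exists>x\<in>ball (0::'a) 1 \<inter> {x. 0 < x \<bullet> i}. \<psi> 1 x * \<psi> 1 x = 0"
      by (intro AE_lebesgue_open_ex) blast+
    then obtain x where x: "x \<in> ball (0::'a) 1 \<inter> {x. 0 < x \<bullet> i}" "\<psi> 1 x * \<psi> 1 x = 0" by blast
    then have "0 < 1 - x \<bullet> x" using norm_less_inverse_iff[of 1 x] by simp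
    then show False using x by (simp add: \<psi>_def bump_grad_def flat_def)
  qed
  have main: "G 1 * m powr (2 - N) \<le> 4 * m * t * (m powr - N * V) + 4 * m * t powr (1 - q) * L"
    if m: "1 \<le> m" and t: "0 < t" for m t
  proof -
    have m0: "0 < m" using m by simp
    have "sobolev_seminorm UNIV 1 q (bump m :: 'a \<Rightarrow> real) < ennreal (C + 1)"
      using order_trans[OF sobolev_seminorm_le_sobolev_norm[OF q(1)] C(2)[OF m]] C(1)
      by (auto intro: le_less_trans ennreal_lessI)
    then obtain g where g: "weak_gradient UNIV (bump m :: 'a \<Rightarrow> real) g"
      "Lp_norm UNIV (ereal q) (\<lambda>x. norm (g x)) < ennreal (C + 1)"
      by (auto simp: sobolev_seminorm_def INF_less_iff)
    have gq: "(\<integral>\<^sup>+x. ennreal (norm (g x) powr q) \<partial>lebesgue) \<le> ennreal L"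
      using ennreal_powr_le_imp_le[of q "C + 1" "\<integral>\<^sup>+x. ennreal (norm (g x) powr q) \<partial>lborel"] g(2) q C(1)
      by (simp add: Lp_norm_eq L_def nn_integral_completion less_imp_le)
    \<comment> \<open>Local integrability makes \<open>g\<close> measurable on compact sets, so the
      estimate is localized to the support of \<open>\<psi> m\<close>.\<close>
    define K where "K = cball (0::'a) (1 / m)"
    have KS: "K \<in> sets lebesgue" by (simp add: K_def)
    have "integrable (lebesgue_on K) g"
      using g(1) by (simp add: weak_gradient_def locally_integrable_def K_def)
    then have [measurable]: "g \<in> borel_measurable (lebesgue_on K)" by simp
    have ts: "\<psi> m \<in> test_functions UNIV"
      using bump_grad_test_function[OF m0 i] by (simp add: \<psi>_def[abs_def])
    have wg: "weak_gradient UNIV (bump m :: 'a \<Rightarrow> real) (bump_grad m)"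
      by (rule weak_gradient_C1[OF bump_has_derivative continuous_bump_grad])
    have test: "(\<integral>x. bump m x * frechet_derivative (\<psi> m) (at x) i \<partial>lebesgue) = - (\<integral>x. (h x \<bullet> i) * \<psi> m x \<partial>lebesgue)"
      if "weak_gradient UNIV (bump m :: 'a \<Rightarrow> real) h" for h
      using that ts i unfolding weak_gradient_def lebesgue_on_UNIV_eq by blast
    \<comment> \<open>Both weak gradients, \<open>g\<close> and the classical one, give the same
      integral of the bump against the derivative of \<open>\<psi> m\<close>.\<close>
    have "(\<integral>x. (g x \<bullet> i) * \<psi> m x \<partial>lebesgue) = (\<integral>x. \<psi> m x * \<psi> m x \<partial>lebesgue)"
      using test[OF g(1)] test[OF wg] unfolding \<psi>_def by linarith
    also have "\<dots> = G m" unfolding G_def by (rule integral_completion) measurable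
    finally have "ennreal (G m) = ennreal (\<integral>x. (g x \<bullet> i) * \<psi> m x \<partial>lebesgue)" by simp
    also have "\<dots> \<le> (\<integral>\<^sup>+x. ennreal \<bar>(g x \<bullet> i) * \<psi> m x\<bar> \<partial>lebesgue)"
    \<comment> \<open>If the product is not integrable, its Bochner integral is 0 by convention and
      the bound is trivial.\<close>
    proof (cases "integrable lebesgue (\<lambda>x. (g x \<bullet> i) * \<psi> m x)")
      case True
      then have "ennreal (norm (\<integral>x. (g x \<bullet> i) * \<psi> m x \<partial>lebesgue)) \<le> (\<integral>\<^sup>+x. ennreal (norm ((g x \<bullet> i) * \<psi> m x)) \<partial>lebesgue)"
        by (rule integral_norm_bound_ennreal)
      then show ?thesis by (auto intro: order_trans[rotated] ennreal_leI)
    qed (simp add: not_integrable_integral_eq)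
    also have "\<dots> \<le> (\<integral>\<^sup>+x. (ennreal (4 * m * t) + ennreal (4 * m * t powr (1 - q)) * ennreal (norm (g x) powr q)) * indicator K x \<partial>lebesgue)"
    proof (rule nn_integral_mono)
      fix x
      show "ennreal \<bar>(g x \<bullet> i) * \<psi> m x\<bar> \<le> (ennreal (4 * m * t) + ennreal (4 * m * t powr (1 - q)) * ennreal (norm (g x) powr q)) * indicator K x"
      proof (cases "x \<in> K")
        case True
        have "\<bar>(g x \<bullet> i) * \<psi> m x\<bar> \<le> norm (g x) * (4 * m)"
          unfolding abs_mult using \<psi>_le[OF m0, of x] Cauchy_Schwarz_ineq2[of "g x" i] i by (intro mult_mono) auto
        also have "\<dots> \<le> (t + t powr (1 - q) * norm (g x) powr q) * (4 * m)"
          using m0 q t by (intro mult_right_mono le_add_powr) auto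
        finally have "\<bar>(g x \<bullet> i) * \<psi> m x\<bar> \<le> 4 * m * t + (4 * m * t powr (1 - q)) * norm (g x) powr q"
          by (simp add: algebra_simps)
        then have "ennreal \<bar>(g x \<bullet> i) * \<psi> m x\<bar> \<le> ennreal (4 * m * t + (4 * m * t powr (1 - q)) * norm (g x) powr q)"
          by (rule ennreal_leI)
        then show ?thesis using True m0 t by (simp add: ennreal_mult)
      qed (use \<psi>_0[OF m0, of x] in \<open>simp add: K_def\<close>)
    qed
    also have "\<dots> = (\<integral>\<^sup>+x. (ennreal (4 * m * t) + ennreal (4 * m * t powr (1 - q)) * ennreal (norm (g x) powr q)) \<partial>lebesgue_on K)"
      using KS by (subst nn_integral_restrict_space) auto
    also have "\<dots> = ennreal (4 * m * t) * emeasure lebesgue K + ennreal (4 * m * t powr (1 - q)) * (\<integral>\<^sup>+x. ennreal (norm (g x) powr q) \<partial>lebesgue_on K)"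
      using KS by (simp add: nn_integral_add nn_integral_cmult emeasure_restrict_space space_restrict_space)
    also have "\<dots> \<le> ennreal (4 * m * t) * ennreal (m powr - N * V) + ennreal (4 * m * t powr (1 - q)) * ennreal L"
    proof (intro add_mono mult_left_mono)
      have "emeasure lebesgue K = emeasure lborel K" by (simp add: K_def)
      also have "\<dots> \<le> emeasure lborel (ball (0::'a) (1 / (m / 2)))"
        using m0 by (intro emeasure_mono) (auto simp: K_def field_simps)
      also have "\<dots> = ennreal ((m / 2) powr - N * measure lborel (ball (0::'a) 1))"
        unfolding N_def by (rule emeasure_lborel_ball_scale) (use m0 in simp)
      also have "(m / 2) powr - N * measure lborel (ball (0::'a) 1) = m powr - N * V"
        using m0 by (simp add: V_def powr_divide powr_minus field_simps)
      finally show "emeasure lebesgue K \<le> ennreal (m powr - N * V)" .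
      have "(\<integral>\<^sup>+x. ennreal (norm (g x) powr q) \<partial>lebesgue_on K) \<le> (\<integral>\<^sup>+x. ennreal (norm (g x) powr q) \<partial>lebesgue)"
        using KS by (subst nn_integral_restrict_space) (auto intro!: nn_integral_mono simp: indicator_def)
      then show "(\<integral>\<^sup>+x. ennreal (norm (g x) powr q) \<partial>lebesgue_on K) \<le> ennreal L" using gq by (rule order_trans)
    qed auto
    also have "\<dots> = ennreal (4 * m * t * (m powr - N * V) + 4 * m * t powr (1 - q) * L)"
      using m0 t V by (simp add: ennreal_mult L_def)
    finally have "G m \<le> 4 * m * t * (m powr - N * V) + 4 * m * t powr (1 - q) * L"
      by (subst (asm) ennreal_le_iff) (use m0 t V in \<open>auto simp: L_def\<close>)
    then show ?thesis using G_scale[OF m0] by (simp add: mult.commute)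
  qed
  \<comment> \<open>The threshold will be \<open>t = e * m\<close>, the order of magnitude of the
    gradient of \<open>bump m\<close>. Then the first term on the right of \<open>main\<close>
    scales like the left side, and this \<open>e\<close> makes it at most half of it.\<close>
  define e where "e = G 1 / (8 * (V + 1))"
  have e: "0 < e" using G_pos V by (simp add: e_def)
  have eV: "4 * e * V \<le> G 1 / 2"
    using G_pos V by (simp add: e_def field_simps)
  have "m powr (q - N) \<le> 8 * e powr (1 - q) * L / G 1" if m: "1 \<le> m" for m
  proof -
    have m0: "0 < m" using m by simp
    have 1: "m * m * m powr - N = m powr (2 - N)"
      using m0 by (simp add: powr_diff powr_minus power2_eq_square divide_simps)
    have 2: "m * m powr (1 - q) = m powr (2 - q)"
      using m0 by (simp add: powr_diff power2_eq_square)
    have "G 1 * m powr (2 - N) \<le> 4 * m * (e * m) * (m powr - N * V) + 4 * m * (e * m) powr (1 - q) * L"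
      using main[OF m, of "e * m"] e m0 by simp
    also have "4 * m * (e * m) * (m powr - N * V) = (4 * e * V) * m powr (2 - N)"
      unfolding 1[symmetric] by simp
    also have "4 * m * (e * m) powr (1 - q) * L = 4 * e powr (1 - q) * L * m powr (2 - q)"
      using e m0 unfolding 2[symmetric] by (simp add: powr_mult)
    also have "(4 * e * V) * m powr (2 - N) \<le> (G 1 / 2) * m powr (2 - N)"
      by (rule mult_right_mono[OF eV]) simp
    finally have "G 1 * m powr (2 - N) \<le> 8 * e powr (1 - q) * L * m powr (2 - q)" by simp
    moreover have "m powr (2 - N) = m powr (2 - q) * m powr (q - N)" by (simp add: powr_add[symmetric])
    ultimately have "m powr (2 - q) * (G 1 * m powr (q - N)) \<le> m powr (2 - q) * (8 * e powr (1 - q) * L)"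
      by (simp add: mult_ac)
    then have "G 1 * m powr (q - N) \<le> 8 * e powr (1 - q) * L"
      using m0 by simp
    then show ?thesis using G_pos by (simp add: field_simps)
  qed
  moreover have "0 < q - N" using q by (simp add: N_def)
  ultimately show False using powr_not_bounded by blast
qed

theorem proposition2p11:
  fixes s p s' :: real and p' :: ereal
  assumes "0 < s" "s \<le> 1" and "1 \<le> p"
    and "s * p = real DIM('a::euclidean_space)" and "s \<noteq> p"
    and "0 \<le> s'" "s' \<le> 1" and "1 \<le> p'"
    and "\<not> ((0 < s' \<and> s' \<le> s \<and> ereal p \<le> p' \<and> p' \<le> ereal (real DIM('a) / s')) \<or>
             (s' = 0 \<and> ereal p \<le> p' \<and> p' < \<infinity>))"
  shows "\<not> continuously_embedded (UNIV :: 'a set) s (ereal p) s' p'"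
proof -
  have "p \<noteq> 1"
  proof
    assume "p = 1"
    then have "1 \<le> s" using assms(4) by (simp add: Suc_le_eq)
    then show False using assms \<open>p = 1\<close> by simp
  qed
  then have s: "0 < s" "s \<le> 1" "1 < p" and sp: "s * p = real DIM('a)" using assms by auto
  show ?thesis
  proof (cases p')
    case (real q)
    then have q: "1 \<le> q" using assms(8) by simp
    show ?thesis
    proof (cases "q < p")
      case True
      then show ?thesis using not_embedded_smaller_exponent[OF s sp q] real by simp
    next
      case False
      then have s': "0 < s'" using assms real by auto
      \<comment> \<open>For \<open>s' \<le> s\<close> this is the failure of the first alternative;
        for \<open>s' > s\<close> it follows from \<open>q \<ge> p\<close> and
        \<open>s * p = N\<close>.\<close>
      have sq: "real DIM('a) < s' * q"
      proof (cases "s' \<le> s")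
        case True
        then show ?thesis using assms False s' real by (auto simp: field_simps)
      next
        case False': False
        have "s * p \<le> s * q" using False s by simp
        also have "\<dots> < s' * q" using False' q by simp
        finally show ?thesis using sp by simp
      qed
      show ?thesis
      proof (cases "s' = 1")
        case True
        then show ?thesis using not_embedded_gradient[OF s sp q] sq real by simp
      next
        case False
        then show ?thesis using not_embedded_fractional[OF s sp q s' _ sq] assms(7) real by simp
      qed
    qed
  next
    case PInf
    show ?thesis
    proof (cases "s' = 0")
      case True
      then show ?thesis using not_embedded_Linfinity[OF s sp] PInf by simp
    next
      case False
      then show ?thesis using not_embedded_Hoelder[OF s sp] assms(6) PInf by simp
    qed
  qed (use assms(8) in auto)
qed

end
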